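(* Let $\mathcal{G}$ be a finite, simple, connected undirected graph with vertex set $V$, and fix a vertex $b_0\in V$. For every facet graph $G$ of $\mathcal{G}$, choose a ribbon structure on $G$ and a basis $(b_0,b_0b_1)$ of $G$ whose base node is $b_0$ (the ribbon structures and base edges may differ between facet graphs). Let $\mathcal{J}(\mathcal{G})$ be the collection of all pairs $(G,T)$ where $G$ is a facet graph of $\mathcal{G}$ and $T$ is a Jaeger tree of $G$ with respect to the chosen ribbon structure and basis. Then for every $i\ge 0$, the coefficient of $t^i$ in the $h^*$-polynomial of the symmetric edge polytope $P_{\mathcal{G}}$ equals the number of pairs $(G,T)\in\mathcal{J}(\mathcal{G})$ such that $T$ has exactly $i$ tail-edges.
   Context: For $v\in V$ let $\mathbf{v}$ denote the corresponding standard basis vector of $\mathbb{R}^V$. The symmetric edge polytope is $P_{\mathcal{G}}=\mathrm{conv}\{\mathbf{u}-\mathbf{v},\mathbf{v}-\mathbf{u}: uv\in E(\mathcal{G})\}$. For a $d$-dimensional lattice polytope $P\subset\mathbb{R}^n$, the Ehrhart series $\sum_{k\ge0}|kP\cap\mathbb{Z}^n|t^k$ equals $h^*(t)/(1-t)^{d+1}$ for a polynomial $h^*(t)$, the $h^*$-polynomial of $P$. A layering of $\mathcal{G}$ is a map $l:V\to\mathbb{Z}$ with $|l(u)-l(v)|\le1$ for every edge $uv$, such that the edge set $E_l=\{uv\in E(\mathcal{G}): |l(u)-l(v)|=1\}$ forms a connected spanning subgraph of $\mathcal{G}$. The facet graph of $l$ is the digraph with vertex set $V$ and edge set $E_l$,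 where $uv\in E_l$ is oriented from $u$ (tail) to $v$ (head), written $\overrightarrow{uv}$, when $l(v)-l(u)=1$. Layerings differing by a constant give the same facet graph. A ribbon structure on a (di)graph assigns to each vertex $x$ a cyclic order of the edges incident to $x$ (ignoring orientations); for an edge $xy$, $xy^+$ denotes the edge following $xy$ in the cyclic order at $x$. A basis is a pair $(b_0,b_0b_1)$ of a vertex and an incident edge. The tour of a spanning tree $T$ (spanning tree of the underlying undirected graph) is the sequence of node-edge pairs starting at $(b_0,b_0b_1)$: if the current pair is $(x,xy)$ and $xy\notin T$ the next pair is $(x,xy^+)$; if $xy\in T$ the next pair is $(y,yx^+)$; the tour stops just before $(b_0,b_0b_1)$ would become current again (each edge $xy$ becomes current exactly twice, once as $(x,xy)$ and once as $(y,yx)$). A spanning tree $T$ of a digraph $G$ is a Jaeger tree if for every edge $\overrightarrow{th}$ of $G$ not in $T$, the pair $(t,th)$ becomes current before $(h,th)$ in the tour of $T$. An edge $\overrightarrow{th}\in T$ is a tail-edge of $T$ if $t$ and $b_0$ lie in the same component of $T-th$, and a head-edge otherwise. *)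

theory Defs
  imports
    "HOL-Analysis.Analysis"
    "HOL-Computational_Algebra.Computational_Algebra"
    "HOL-Combinatorics.Orbits"
begin

unbundle no fps_syntax

section \<open>Undirected graphs\<close>

text \<open>The vertex set is the universe of the finite type \<open>'v\<close>; an undirected graph is
  its set of edges, each edge being a two-element set. Subgraphs given by a set of
  edges are therefore always spanning.\<close>

definition simple_graph :: "'v set set \<Rightarrow> bool" where
  "simple_graph E \<longleftrightarrow> (\<forall>e\<in>E. card e = 2)"

definition same_component :: "'v set set \<Rightarrow> 'v \<Rightarrow> 'v \<Rightarrow> bool" where
  "same_component F u v \<longleftrightarrow> (u, v) \<in> {(x, y). {x, y} \<in> F}\<^sup>*"

definition connected_graph :: "'v set set \<Rightarrow> bool" where
  "connected_graph F \<longleftrightarrow> (\<forall>u v. same_component F u v)"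

definition is_cycle :: "'v set set \<Rightarrow> 'v list \<Rightarrow> bool" where
  "is_cycle F xs \<longleftrightarrow> 3 \<le> length xs \<and> distinct xs \<and>
     (\<forall>i<length xs. {xs ! i, xs ! (Suc i mod length xs)} \<in> F)"

definition spanning_tree :: "'v set set \<Rightarrow> 'v set set \<Rightarrow> bool" where
  "spanning_tree F T \<longleftrightarrow> T \<subseteq> F \<and> connected_graph T \<and> (\<nexists>xs. is_cycle T xs)"

definition incident_edges :: "'v set set \<Rightarrow> 'v \<Rightarrow> 'v set set" where
  "incident_edges F x = {e \<in> F. x \<in> e}"


section \<open>Layerings and facet graphs\<close>

definition layer_edges :: "'v set set \<Rightarrow> ('v \<Rightarrow> int) \<Rightarrow> 'v set set" where
  "layer_edges E l = {{u, v} | u v. {u, v} \<in> E \<and> \<bar>l u - l v\<bar> = 1}"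

definition layering :: "'v set set \<Rightarrow> ('v \<Rightarrow> int) \<Rightarrow> bool" where
  "layering E l \<longleftrightarrow> (\<forall>u v. {u, v} \<in> E \<longrightarrow> \<bar>l u - l v\<bar> \<le> 1) \<and>
     connected_graph (layer_edges E l)"

text \<open>A digraph is its set of arcs \<open>(tail, head)\<close>.\<close>

definition facet_graph :: "'v set set \<Rightarrow> ('v \<Rightarrow> int) \<Rightarrow> ('v \<times> 'v) set" where
  "facet_graph E l = {(u, v). {u, v} \<in> layer_edges E l \<and> l v - l u = 1}"

definition facet_graphs :: "'v set set \<Rightarrow> ('v \<times> 'v) set set" where
  "facet_graphs E = {facet_graph E l | l. layering E l}"

definition underlying :: "('v \<times> 'v) set \<Rightarrow> 'v set set" where
  "underlying G = {{t, h} | t h. (t, h) \<in> G}"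


section \<open>Ribbon structures, tours and Jaeger trees\<close>

text \<open>A ribbon structure is given by its successor function: \<open>rib x e\<close> is the edge following
  \<open>e\<close> in the cyclic order at \<open>x\<close>. Its values on edges not incident to \<open>x\<close> are irrelevant.\<close>

definition ribbon_structure ::
    "('v \<times> 'v) set \<Rightarrow> ('v \<Rightarrow> 'v set \<Rightarrow> 'v set) \<Rightarrow> bool" where
  "ribbon_structure G rib \<longleftrightarrow>
     (\<forall>x. incident_edges (underlying G) x \<noteq> {} \<longrightarrow>
        cyclic_on (rib x) (incident_edges (underlying G) x))"

definition is_basis :: "('v \<times> 'v) set \<Rightarrow> 'v \<times> 'v set \<Rightarrow> bool" where
  "is_basis G b \<longleftrightarrow> snd b \<in> incident_edges (underlying G) (fst b)"

definition other_end :: "'v \<Rightarrow> 'v set \<Rightarrow> 'v" where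
  "other_end x e = (THE y. e = {x, y})"

definition tour_step ::
    "('v \<Rightarrow> 'v set \<Rightarrow> 'v set) \<Rightarrow> 'v set set \<Rightarrow> 'v \<times> 'v set \<Rightarrow> 'v \<times> 'v set" where
  "tour_step rib T = (\<lambda>(x, e).
     if e \<in> T then (other_end x e, rib (other_end x e) e) else (x, rib x e))"

definition tour ::
    "('v \<Rightarrow> 'v set \<Rightarrow> 'v set) \<Rightarrow> 'v \<times> 'v set \<Rightarrow> 'v set set \<Rightarrow> ('v \<times> 'v set) list" where
  "tour rib b T = map (\<lambda>n. (tour_step rib T ^^ n) b)
     [0..<(LEAST n. 0 < n \<and> (tour_step rib T ^^ n) b = b)]"

definition current_before ::
    "('v \<Rightarrow> 'v set \<Rightarrow> 'v set) \<Rightarrow> 'v \<times> 'v set \<Rightarrow> 'v set set \<Rightarrow>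
     'v \<times> 'v set \<Rightarrow> 'v \<times> 'v set \<Rightarrow> bool" where
  "current_before rib b T p q \<longleftrightarrow>
     (\<exists>i j. i < j \<and> j < length (tour rib b T) \<and> tour rib b T ! i = p \<and> tour rib b T ! j = q)"

definition jaeger_tree ::
    "('v \<times> 'v) set \<Rightarrow> ('v \<Rightarrow> 'v set \<Rightarrow> 'v set) \<Rightarrow> 'v \<times> 'v set \<Rightarrow> 'v set set \<Rightarrow> bool" where
  "jaeger_tree G rib b T \<longleftrightarrow> spanning_tree (underlying G) T \<and>
     (\<forall>(t, h)\<in>G. {t, h} \<notin> T \<longrightarrow> current_before rib b T (t, {t, h}) (h, {t, h}))"

definition tail_edges :: "('v \<times> 'v) set \<Rightarrow> 'v \<Rightarrow> 'v set set \<Rightarrow> ('v \<times> 'v) set" where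
  "tail_edges G b0 T =
     {(t, h). (t, h) \<in> G \<and> {t, h} \<in> T \<and> same_component (T - {{t, h}}) t b0}"


section \<open>Symmetric edge polytopes and \<open>h\<^sup>*\<close>-polynomials\<close>

text \<open>Since \<open>{u, v} = {v, u}\<close>, both differences occur for every edge.\<close>

definition symmetric_edge_polytope :: "'v set set \<Rightarrow> (real ^ 'v::finite) set" where
  "symmetric_edge_polytope E =
     convex hull {axis u 1 - axis v 1 | u v. {u, v} \<in> E}"

definition ehrhart_series :: "(real ^ 'n::finite) set \<Rightarrow> real fps" where
  "ehrhart_series P =
     Abs_fps (\<lambda>k. real (card ((\<lambda>x. real k *\<^sub>R x) ` P \<inter> {x. \<forall>i. x $ i \<in> \<int>})))"

definition h_star :: "(real ^ 'n::finite) set \<Rightarrow> real poly" where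
  "h_star P =
     (THE p. ehrhart_series P = fps_of_poly p / (1 - fps_X) ^ (nat (aff_dim P) + 1))"

lemma h_star_eqI:
  assumes "ehrhart_series P = fps_of_poly p / (1 - fps_X) ^ (nat (aff_dim P) + 1)"
  shows "h_star P = p"
  unfolding h_star_def
proof (rule the_equality)
  fix q assume "ehrhart_series P = fps_of_poly q / (1 - fps_X) ^ (nat (aff_dim P) + 1)"
  define D :: "real fps" where "D = (1 - fps_X) ^ (nat (aff_dim P) + 1)"
  have D0: "fps_nth D 0 \<noteq> 0"
    by (simp add: D_def)
  hence "fps_of_poly q * inverse D = fps_of_poly p * inverse D"
    using assms \<open>ehrhart_series P = fps_of_poly q / _\<close>
    by (metis D_def fps_divide_unit)
  moreover have "inverse D \<noteq> 0"
    using D0 by auto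
  ultimately show "q = p"
    by (simp add: fps_of_poly_eq_iff)
qed (fact assms)

end

theory Submission
  imports Defs
begin

text \<open>Move a lattice point \<open>x\<close> with coordinate sum zero slightly towards \<open>\<Sum>\<^sub>v (b0 - v)\<close>, so that it
  avoids all hyperplanes on which the coordinates of a proper vertex subset sum to zero. A minimum
  cost flow with this demand is supported on a tree whose potential is a layering; it singles out
  one facet graph \<open>G\<close>. Within \<open>G\<close>, exactly one Jaeger tree carries the demand by a nonnegative flow.
  For uniqueness, take the first edge at which the tours of two such trees differ and compare the
  two flows across its fundamental cut. For existence, pivot until the decisions made along the
  tour are lexicographically optimal; layerings ensure that every pivot has a leaving arc.

  Moving \<open>x\<close> back, the cones over the simplices of the Jaeger trees, with the facets opposite
  tail-edges removed, partition the lattice points, and the sum of the coefficients of \<open>x\<close> is its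
  gauge. A unimodular simplex with apex \<open>0\<close> and \<open>i\<close> removed facets contributes
  \<open>t\<^sup>i / (1 - t)\<^sup>d\<^sup>+\<^sup>1\<close> to the Ehrhart series.\<close>

section \<open>Trees\<close>

text \<open>The cells come from linear programming with unit cost per arc. A layering is an integral
  dual solution: it pairs to at most 1 with every vertex of the polytope and to exactly 1 with the
  arcs of its facet graph. Inside one facet all trees therefore have equal cost, and only the ribbon
  structure selects among them; as this happens after the facet is fixed, the structures of
  different facets need not fit together.

  The obstacle is the boundary shared by cells: the perturbation must assign it consistently across
  facets. Its direction gives positive demand to \<open>b0\<close> alone, so an arc whose head side
  misses \<open>b0\<close> needs a positive coefficient before the move, and these arcs are the
  tail-edges.

  Deviations are compared lexicographically because an exchange leaves the tour unchanged until an
  exchanged edge becomes current; the comparison is settled there.\<close>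

lemma same_component_refl [simp]: "same_component F u u"
  by (simp add: same_component_def)

lemma same_component_edge: "{u, v} \<in> F \<Longrightarrow> same_component F u v"
  by (auto simp: same_component_def)

lemma same_component_trans:
  "same_component F u v \<Longrightarrow> same_component F v w \<Longrightarrow> same_component F u w"
  unfolding same_component_def by (rule rtrancl_trans)

lemma same_component_sym: "same_component F u v \<Longrightarrow> same_component F v u"
proof -
  have "sym {(x, y). {x, y} \<in> F}"
    by (auto simp: sym_def insert_commute)
  then show "same_component F u v \<Longrightarrow> same_component F v u"
    unfolding same_component_def using sym_rtrancl symD by metis
qed

lemma same_component_mono: "same_component F u v \<Longrightarrow> F \<subseteq> F' \<Longrightarrow> same_component F' u v"
  unfolding same_component_def by (rule rtrancl_mono[THEN subsetD, rotated]) auto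

text \<open>The induction principle behind most connectivity arguments below, with a truth value, an
  indicator or a potential as \<open>\<phi>\<close>.\<close>

lemma same_component_const:
  assumes "same_component F u v" "\<And>a b. {a, b} \<in> F \<Longrightarrow> \<phi> a = \<phi> b"
  shows "\<phi> u = \<phi> v"
proof -
  have "(u, v) \<in> {(x, y). {x, y} \<in> F}\<^sup>*"
    using assms(1) by (simp add: same_component_def)
  then show ?thesis
    by induction (use assms(2) in auto)
qed

lemma same_component_path:
  assumes "same_component F u v"
  obtains xs where "xs \<noteq> []" "distinct xs" "hd xs = u" "last xs = v"
    "\<And>i. Suc i < length xs \<Longrightarrow> {xs ! i, xs ! Suc i} \<in> F"
proof -
  have "(u, v) \<in> {(x, y). {x, y} \<in> F}\<^sup>*"
    using assms by (simp add: same_component_def)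
  then have "\<exists>xs. xs \<noteq> [] \<and> distinct xs \<and> hd xs = u \<and> last xs = v \<and>
    (\<forall>i. Suc i < length xs \<longrightarrow> {xs ! i, xs ! Suc i} \<in> F)"
  proof induction
    case base
    show ?case by (rule exI[of _ "[u]"]) auto
  next
    case (step y z)
    then obtain xs where xs: "xs \<noteq> []" "distinct xs" "hd xs = u" "last xs = y"
      "\<And>i. Suc i < length xs \<Longrightarrow> {xs ! i, xs ! Suc i} \<in> F" by blast
    show ?case
    proof (cases "z \<in> set xs")
      case True
      then obtain j where j: "j < length xs" "xs ! j = z"
        by (auto simp: in_set_conv_nth)
      have "last (take (Suc j) xs) = z"
        using j by (simp add: take_Suc_conv_app_nth)
      then show ?thesis
        using xs j by (intro exI[of _ "take (Suc j) xs"]) auto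
    next
      case False
      have "{(xs @ [z]) ! i, (xs @ [z]) ! Suc i} \<in> F" if "Suc i < length (xs @ [z])" for i
      proof (cases "Suc i < length xs")
        case True
        then show ?thesis using xs(5)[of i] by (simp add: nth_append)
      next
        case False
        then have "Suc i = length xs" using that by simp
        then have "xs ! i = y" using xs(1,4) by (metis diff_Suc_1 last_conv_nth)
        then show ?thesis using step(2) \<open>Suc i = length xs\<close> by (simp add: nth_append)
      qed
      then show ?thesis
        using xs False by (intro exI[of _ "xs @ [z]"]) auto
    qed
  qed
  then show ?thesis using that by blast
qed

text \<open>Trees are characterised by their edges being bridges, which is what the cuts below rely on.\<close>

definition tree :: "'v set set \<Rightarrow> bool" where
  "tree T \<longleftrightarrow> connected_graph T \<and>
     (\<forall>u v. {u, v} \<in> T \<longrightarrow> \<not> same_component (T - {{u, v}}) u v)"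

text \<open>The edge that closes the cycle is bypassed by the rest of the cycle. Length at least 3
  keeps it distinct from the edges of this bypass.\<close>

lemma cycle_imp_not_bridge:
  assumes "is_cycle T xs"
  obtains u v where "{u, v} \<in> T" "same_component (T - {{u, v}}) u v"
proof -
  define k where "k = length xs"
  have k: "3 \<le> k" "distinct xs"
    and edges: "\<And>i. i < k \<Longrightarrow> {xs ! i, xs ! (Suc i mod k)} \<in> T"
    using assms by (auto simp: is_cycle_def k_def)
  define e where "e = {xs ! 0, xs ! (k - 1)}"
  have "same_component (T - {e}) (xs ! 0) (xs ! i)" if "i < k" for i
    using that
  proof (induction i)
    case (Suc i)
    have "{xs ! i, xs ! Suc i} \<in> T" using edges[of i] Suc.prems by simp
    moreover have "{xs ! i, xs ! Suc i} \<noteq> e"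
    proof
      assume "{xs ! i, xs ! Suc i} = e"
      then have "xs ! i = xs ! 0 \<and> xs ! Suc i = xs ! (k - 1) \<or> xs ! i = xs ! (k - 1)"
        unfolding e_def doubleton_eq_iff by blast
      then have "i = 0 \<and> Suc i = k - 1 \<or> i = k - 1"
        using nth_eq_iff_index_eq[OF k(2), of i 0] nth_eq_iff_index_eq[OF k(2), of "Suc i" "k - 1"]
          nth_eq_iff_index_eq[OF k(2), of i "k - 1"] k(1) Suc.prems k_def by fastforce
      then show False
        using k(1) Suc.prems by linarith
    qed
    ultimately show ?case
      using Suc by (metis Diff_iff Suc_lessD same_component_edge same_component_trans singletonD)
  qed simp
  moreover have "e \<in> T"
    using edges[of "k - 1"] k(1) by (simp add: e_def insert_commute)
  ultimately show ?thesis
    using k(1) that[of "xs ! 0" "xs ! (k - 1)"] by (simp add: e_def)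
qed

lemma not_bridge_imp_cycle:
  assumes "{u, v} \<in> T" "u \<noteq> v" "same_component (T - {{u, v}}) u v"
  obtains xs where "is_cycle T xs"
proof -
  obtain xs where xs: "xs \<noteq> []" "distinct xs" "hd xs = u" "last xs = v"
    "\<And>i. Suc i < length xs \<Longrightarrow> {xs ! i, xs ! Suc i} \<in> T - {{u, v}}"
    using same_component_path[OF assms(3)] by blast
  have u: "xs ! 0 = u" and v: "xs ! (length xs - 1) = v"
    using xs by (auto simp: hd_conv_nth last_conv_nth)
  have "length xs \<noteq> 1" using u v assms(2) by auto
  \<comment> \<open>A path with two vertices would be the removed edge itself.\<close>
  moreover have "length xs \<noteq> 2" using u v xs(5)[of 0] by auto
  moreover have "length xs \<noteq> 0" using xs(1) by simp
  ultimately have "3 \<le> length xs" by linarith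
  moreover have "{xs ! i, xs ! (Suc i mod length xs)} \<in> T" if "i < length xs" for i
  proof (cases "Suc i < length xs")
    case True
    then show ?thesis using xs(5)[of i] by simp
  next
    case False
    then have "Suc i = length xs" using that by simp
    then show ?thesis using u v assms(1) by (metis diff_Suc_1 insert_commute mod_self)
  qed
  ultimately show ?thesis using that xs(2) by (auto simp: is_cycle_def)
qed

text \<open>Simplicity rules out loops: \<open>is_cycle\<close> does not see a loop, and yet a loop
  is never a bridge because \<open>same_component\<close> is reflexive.\<close>

lemma spanning_tree_iff:
  assumes "simple_graph F"
  shows "spanning_tree F T \<longleftrightarrow> T \<subseteq> F \<and> tree T"
proof (cases "T \<subseteq> F")
  case True
  have "(\<nexists>xs. is_cycle T xs) \<longleftrightarrow>
    (\<forall>u v. {u, v} \<in> T \<longrightarrow> \<not> same_component (T - {{u, v}}) u v)"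
  proof
    assume no: "\<nexists>xs. is_cycle T xs"
    show "\<forall>u v. {u, v} \<in> T \<longrightarrow> \<not> same_component (T - {{u, v}}) u v"
    proof (intro allI impI notI)
      fix u v assume uv: "{u, v} \<in> T" "same_component (T - {{u, v}}) u v"
      have "card {u, v} = 2" using True assms uv(1) by (auto simp: simple_graph_def)
      then have "u \<noteq> v" by auto
      then show False using not_bridge_imp_cycle uv no by metis
    qed
  next
    assume "\<forall>u v. {u, v} \<in> T \<longrightarrow> \<not> same_component (T - {{u, v}}) u v"
    then show "\<nexists>xs. is_cycle T xs" using cycle_imp_not_bridge by metis
  qed
  then show ?thesis by (auto simp: spanning_tree_def tree_def)
qed (simp add: spanning_tree_def)

text \<open>In an inclusion-minimal connected edge set every edge is a bridge, since any other edge
  could be deleted.\<close>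

lemma connected_imp_tree:
  fixes E :: "'v::finite set set"
  assumes "connected_graph E"
  obtains T where "T \<subseteq> E" "tree T"
proof -
  have "finite {T. T \<subseteq> E \<and> connected_graph T}" "{T. T \<subseteq> E \<and> connected_graph T} \<noteq> {}"
    using assms by auto
  from finite_has_minimal[OF this] obtain T where T: "T \<subseteq> E" "connected_graph T"
    and min: "\<And>T'. T' \<subseteq> E \<Longrightarrow> connected_graph T' \<Longrightarrow> T' \<subseteq> T \<Longrightarrow> T' = T"
    by (smt (verit, best) mem_Collect_eq)
  have "\<not> same_component (T - {{u, v}}) u v" if uv: "{u, v} \<in> T" for u v
  proof
    assume sc: "same_component (T - {{u, v}}) u v"
    have "same_component (T - {{u, v}}) a b" for a b
    proof -
      have "same_component T a b" using T(2) by (simp add: connected_graph_def)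
      then have "same_component (T - {{u, v}}) a a = same_component (T - {{u, v}}) a b"
      proof (rule same_component_const)
        fix c d assume cd: "{c, d} \<in> T"
        have "same_component (T - {{u, v}}) c d"
        proof (cases "{c, d} = {u, v}")
          case True
          then show ?thesis using sc same_component_sym by (auto simp: doubleton_eq_iff)
        next
          case False
          then show ?thesis using cd by (auto intro: same_component_edge)
        qed
        then show "same_component (T - {{u, v}}) a c = same_component (T - {{u, v}}) a d"
          by (meson same_component_sym same_component_trans)
      qed
      then show ?thesis by simp
    qed
    then have "T - {{u, v}} = T" using T by (intro min) (auto simp: connected_graph_def)
    then show False using uv by blast
  qed
  then show ?thesis using that T by (auto simp: tree_def)
qed

section \<open>Oriented trees, cuts and flows\<close>

lemma underlying_iff: "{u, v} \<in> underlying A \<longleftrightarrow> (u, v) \<in> A \<or> (v, u) \<in> A"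
  by (auto simp: underlying_def doubleton_eq_iff)

lemma underlyingE:
  assumes "e \<in> underlying A"
  obtains t h where "(t, h) \<in> A" "e = {t, h}"
  using assms by (auto simp: underlying_def)

lemma underlying_image: "underlying A = (\<lambda>g. {fst g, snd g}) ` A"
  by (force simp: underlying_def)

text \<open>Excluding antiparallel arcs, and with them loops, makes arcs correspond to underlying
  edges one to one, see \<open>otree_arc_eq\<close>.\<close>

definition otree :: "('v \<times> 'v) set \<Rightarrow> bool" where
  "otree A \<longleftrightarrow> tree (underlying A) \<and> (\<forall>t h. (t, h) \<in> A \<longrightarrow> (h, t) \<notin> A)"

definition head_side :: "('v \<times> 'v) set \<Rightarrow> 'v \<times> 'v \<Rightarrow> 'v set" where
  "head_side A g = {v. same_component (underlying A - {{fst g, snd g}}) (snd g) v}"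

text \<open>On a tree the demand of the head side can only enter through \<open>g\<close>, so this
  is the coefficient of \<open>g\<close> in every flow, see \<open>flow_unique\<close>.\<close>

definition cut :: "('v \<times> 'v) set \<Rightarrow> ('v \<Rightarrow> int) \<Rightarrow> 'v \<times> 'v \<Rightarrow> int" where
  "cut A y g = (\<Sum>v\<in>head_side A g. y v)"

text \<open>\<open>c\<close> is a flow with net inflow \<open>y\<close>, tested against potentials instead of vertex by vertex.\<close>

definition flow :: "('v::finite \<times> 'v) set \<Rightarrow> ('v \<times> 'v \<Rightarrow> int) \<Rightarrow> ('v \<Rightarrow> int) \<Rightarrow> bool" where
  "flow A c y \<longleftrightarrow>
     (\<forall>\<phi>. (\<Sum>v\<in>UNIV. \<phi> v * y v) = (\<Sum>g\<in>A. c g * (\<phi> (snd g) - \<phi> (fst g))))"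

lemma snd_in_head_side: "snd g \<in> head_side A g"
  by (simp add: head_side_def)

lemma head_side_edge:
  assumes "{u, v} \<in> underlying A" "{u, v} \<noteq> {fst g, snd g}"
  shows "u \<in> head_side A g \<longleftrightarrow> v \<in> head_side A g"
proof -
  have "same_component (underlying A - {{fst g, snd g}}) u v"
    using assms by (auto intro: same_component_edge)
  then show ?thesis
    unfolding head_side_def by (auto intro: same_component_trans dest: same_component_sym)
qed

lemma connected_const:
  assumes "connected_graph (underlying A)" "\<And>g. g \<in> A \<Longrightarrow> \<phi> (fst g) = \<phi> (snd g)"
  shows "\<phi> u = \<phi> v"
proof -
  have "same_component (underlying A) u v"
    using assms(1) by (simp add: connected_graph_def)
  then show ?thesis
    by (rule same_component_const) (use assms(2) in \<open>auto simp: underlying_iff\<close>)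
qed

context
  fixes A :: "('v::finite \<times> 'v) set"
  assumes A: "otree A"
begin

lemma otree_connected: "connected_graph (underlying A)"
  using A by (simp add: otree_def tree_def)

lemma fst_notin_head_side:
  assumes "g \<in> A" shows "fst g \<notin> head_side A g"
proof -
  have "{fst g, snd g} \<in> underlying A"
    using assms by (simp add: underlying_iff)
  then have "\<not> same_component (underlying A - {{fst g, snd g}}) (fst g) (snd g)"
    using A by (simp add: otree_def tree_def)
  then show ?thesis
    by (auto simp: head_side_def dest: same_component_sym)
qed

lemma otree_arc_eq:
  assumes "g \<in> A" "g' \<in> A" "{fst g, snd g} = {fst g', snd g'}"
  shows "g = g'"
proof -
  have "(snd g, fst g) \<notin> A"
    using A assms(1) by (auto simp: otree_def prod.expand)
  then show ?thesis
    using assms by (metis doubleton_eq_iff prod.collapse)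
qed

lemma head_side_arc:
  assumes "g \<in> A" "g' \<in> A" "g' \<noteq> g"
  shows "fst g' \<in> head_side A g \<longleftrightarrow> snd g' \<in> head_side A g"
proof -
  have "{fst g', snd g'} \<noteq> {fst g, snd g}"
    using assms otree_arc_eq by blast
  then show ?thesis
    using assms by (intro head_side_edge) (simp_all add: underlying_iff)
qed

text \<open>The indicator of \<open>head_side A g\<close> is the potential dual to \<open>g\<close>:
  it jumps along \<open>g\<close> only. The expansion of potentials and the uniqueness of flows both
  rest on this duality.\<close>

lemma head_side_diff:
  assumes "g \<in> A" "g' \<in> A"
  shows "of_bool (snd g' \<in> head_side A g) - of_bool (fst g' \<in> head_side A g) =
    (of_bool (g' = g) :: int)"
  using assms head_side_arc[of g g'] fst_notin_head_side[of g] snd_in_head_side[of g A] by auto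

text \<open>Telescoping along the tree path from \<open>u\<close> to \<open>v\<close>, with the path
  encoded by signs: the last factor is nonzero exactly on the arcs that it crosses.\<close>

lemma potential_diff:
  fixes \<phi> :: "'v \<Rightarrow> int"
  shows "\<phi> v - \<phi> u = (\<Sum>g\<in>A. (\<phi> (snd g) - \<phi> (fst g)) *
    (of_bool (v \<in> head_side A g) - of_bool (u \<in> head_side A g)))"
proof -
  \<comment> \<open>\<open>\<psi>\<close> is \<open>\<phi>\<close> minus its expansion in the dual
    potentials; it has no jump on any arc, so it is constant.\<close>
  define \<psi> where "\<psi> w = \<phi> w - (\<Sum>g\<in>A. (\<phi> (snd g) - \<phi> (fst g)) * of_bool (w \<in> head_side A g))"
    for w
  have "\<psi> u = \<psi> v"
  proof (rule connected_const[OF otree_connected])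
    fix g assume g: "g \<in> A"
    have "\<psi> (snd g) - \<psi> (fst g) = \<phi> (snd g) - \<phi> (fst g) -
      (\<Sum>g'\<in>A. (\<phi> (snd g') - \<phi> (fst g')) *
        (of_bool (snd g \<in> head_side A g') - of_bool (fst g \<in> head_side A g')))"
      by (simp add: \<psi>_def sum_subtractf right_diff_distrib)
    also have "(\<Sum>g'\<in>A. (\<phi> (snd g') - \<phi> (fst g')) *
        (of_bool (snd g \<in> head_side A g') - of_bool (fst g \<in> head_side A g'))) =
      (\<Sum>g'\<in>A. (\<phi> (snd g') - \<phi> (fst g')) * of_bool (g = g'))"
      using g by (intro sum.cong refl) (simp add: head_side_diff)
    also have "\<dots> = \<phi> (snd g) - \<phi> (fst g)"
      using g by (simp add: of_bool_def if_distrib[of "\<lambda>x. _ * x"] sum.delta' cong: if_cong)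
    finally show "\<psi> (fst g) = \<psi> (snd g)" by simp
  qed
  then show ?thesis
    by (simp add: \<psi>_def sum_subtractf right_diff_distrib)
qed

lemma flow_cut:
  assumes "(\<Sum>v\<in>UNIV. y v) = 0"
  shows "flow A (cut A y) y"
  unfolding flow_def
proof
  fix \<phi> :: "'v \<Rightarrow> int"
  \<comment> \<open>\<open>undefined\<close> serves as an arbitrary reference vertex; zero total
    demand allows the shift.\<close>
  have "(\<Sum>v\<in>UNIV. \<phi> v * y v) = (\<Sum>v\<in>UNIV. (\<phi> v - \<phi> undefined) * y v)"
    using assms by (simp add: left_diff_distrib sum_subtractf flip: sum_distrib_left)
  also have "\<dots> = (\<Sum>v\<in>UNIV. \<Sum>g\<in>A. (\<phi> (snd g) - \<phi> (fst g)) *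
    (of_bool (v \<in> head_side A g) - of_bool (undefined \<in> head_side A g)) * y v)"
    by (subst potential_diff) (simp add: sum_distrib_right)
  also have "\<dots> = (\<Sum>g\<in>A. \<Sum>v\<in>UNIV. (\<phi> (snd g) - \<phi> (fst g)) *
    (of_bool (v \<in> head_side A g) - of_bool (undefined \<in> head_side A g)) * y v)"
    by (rule sum.swap)
  also have "\<dots> = (\<Sum>g\<in>A. cut A y g * (\<phi> (snd g) - \<phi> (fst g)))"
  proof (intro sum.cong refl)
    fix g
    have "(\<Sum>v\<in>UNIV. (\<phi> (snd g) - \<phi> (fst g)) *
        (of_bool (v \<in> head_side A g) - of_bool (undefined \<in> head_side A g)) * y v) =
      (\<phi> (snd g) - \<phi> (fst g)) * ((\<Sum>v\<in>UNIV. of_bool (v \<in> head_side A g) * y v) -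
        of_bool (undefined \<in> head_side A g) * (\<Sum>v\<in>UNIV. y v))"
      unfolding sum_distrib_left sum_subtractf[symmetric]
      by (intro sum.cong refl) (simp only: right_diff_distrib left_diff_distrib mult.assoc)
    also have "(\<Sum>v\<in>UNIV. of_bool (v \<in> head_side A g) * y v) = cut A y g"
      unfolding cut_def by (intro sum.mono_neutral_cong_right) auto
    finally show "(\<Sum>v\<in>UNIV. (\<phi> (snd g) - \<phi> (fst g)) *
        (of_bool (v \<in> head_side A g) - of_bool (undefined \<in> head_side A g)) * y v) =
      cut A y g * (\<phi> (snd g) - \<phi> (fst g))"
      using assms by simp
  qed
  finally show "(\<Sum>v\<in>UNIV. \<phi> v * y v) = (\<Sum>g\<in>A. cut A y g * (\<phi> (snd g) - \<phi> (fst g)))" .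
qed

end

lemma flow_sum_subset:
  fixes y :: "'v::finite \<Rightarrow> int"
  assumes "flow A c y"
  shows "(\<Sum>v\<in>S. y v) = (\<Sum>g\<in>A. c g * (of_bool (snd g \<in> S) - of_bool (fst g \<in> S)))"
proof -
  have "(\<Sum>v\<in>S. y v) = (\<Sum>v\<in>UNIV. of_bool (v \<in> S) * y v)"
    by (intro sum.mono_neutral_cong_left) auto
  also have "\<dots> = (\<Sum>g\<in>A. c g * (of_bool (snd g \<in> S) - of_bool (fst g \<in> S)))"
    using assms unfolding flow_def by (rule allE)
  finally show ?thesis .
qed

lemma flow_sum_zero: "flow A c y \<Longrightarrow> (\<Sum>v\<in>UNIV. y v) = 0"
  using flow_sum_subset[of A c y UNIV] by simp

text \<open>Only \<open>g\<close> crosses the cut at its head side. Integral demands thus have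
  integral coefficients, which is the unimodularity of the simplices.\<close>

lemma flow_unique:
  fixes A :: "('v::finite \<times> 'v) set"
  assumes "otree A" "flow A c y" "g \<in> A"
  shows "c g = cut A y g"
proof -
  have "cut A y g = (\<Sum>g'\<in>A. c g' * of_bool (g' = g))"
    unfolding cut_def flow_sum_subset[OF assms(2)]
    using assms by (intro sum.cong refl) (simp add: head_side_diff)
  then show ?thesis
    using assms(3) by (simp add: of_bool_def if_distrib[of "\<lambda>x. _ * x"] cong: if_cong)
qed

lemma tree_sides:
  assumes "tree T" "{a, b} \<in> T"
  shows "{w. same_component (T - {{a, b}}) b w} = - {w. same_component (T - {{a, b}}) a w}"
proof -
  let ?sc = "same_component (T - {{a, b}})"
  have no: "\<not> ?sc a b" using assms by (simp add: tree_def)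
  have "?sc a w \<or> ?sc b w" for w
  proof -
    have "same_component T a w" using assms(1) by (simp add: tree_def connected_graph_def)
    \<comment> \<open>Being reachable from \<open>a\<close> or from \<open>b\<close> is constant
      along all edges of \<open>T\<close>, including the removed one.\<close>
    then have "(?sc a a \<or> ?sc b a) = (?sc a w \<or> ?sc b w)"
    proof (rule same_component_const)
      fix c d assume cd: "{c, d} \<in> T"
      show "(?sc a c \<or> ?sc b c) = (?sc a d \<or> ?sc b d)"
      proof (cases "{c, d} = {a, b}")
        case True
        then show ?thesis by (auto simp: doubleton_eq_iff)
      next
        case False
        then have "?sc c d" using cd by (auto intro: same_component_edge)
        then show ?thesis by (meson same_component_sym same_component_trans)
      qed
    qed
    then show ?thesis by simp
  qed
  moreover have "\<not> (?sc a w \<and> ?sc b w)" for w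
    using no by (meson same_component_sym same_component_trans)
  ultimately show ?thesis by blast
qed

lemma same_component_tail_side:
  assumes "otree A" "g \<in> A" "w \<notin> head_side A g"
  shows "same_component (underlying A - {{fst g, snd g}}) (fst g) w"
  using tree_sides[of "underlying A" "fst g" "snd g"] assms
  by (auto simp: otree_def head_side_def underlying_iff)

section \<open>Generic demands and the cones of trees\<close>

definition positive :: "('v \<times> 'v) set \<Rightarrow> ('v \<Rightarrow> int) \<Rightarrow> bool" where
  "positive A y \<longleftrightarrow> (\<forall>g\<in>A. cut A y g > 0)"

text \<open>No cut of any tree vanishes, so nonnegative flows are positive and pivots are never
  degenerate.\<close>

definition generic :: "('v::finite \<Rightarrow> int) \<Rightarrow> bool" where
  "generic y \<longleftrightarrow> (\<Sum>v\<in>UNIV. y v) = 0 \<and> (\<forall>S. S \<noteq> {} \<longrightarrow> S \<noteq> UNIV \<longrightarrow> (\<Sum>v\<in>S. y v) \<noteq> 0)"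

lemma generic_cut: "generic y \<Longrightarrow> otree A \<Longrightarrow> g \<in> A \<Longrightarrow> cut A y g \<noteq> 0"
  unfolding generic_def cut_def
  using snd_in_head_side[of g A] fst_notin_head_side[of A g] by (metis UNIV_I empty_iff)

lemma positive_iff_flow:
  assumes "generic y" "otree A"
  shows "positive A y \<longleftrightarrow> (\<exists>c. flow A c y \<and> (\<forall>g\<in>A. c g \<ge> 0))"
proof
  assume "positive A y"
  then show "\<exists>c. flow A c y \<and> (\<forall>g\<in>A. c g \<ge> 0)"
    using flow_cut[OF assms(2)] assms(1) by (force simp: positive_def generic_def)
next
  assume "\<exists>c. flow A c y \<and> (\<forall>g\<in>A. c g \<ge> 0)"
  then show "positive A y"
    unfolding positive_def
    using flow_unique[OF assms(2)] generic_cut[OF assms] by (metis order_le_less)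
qed

text \<open>The sum of the dual potentials of all arcs. It is the dual solution belonging to the
  tree, hence the candidate for a layering.\<close>

lemma otree_potential:
  fixes A :: "('v::finite \<times> 'v) set"
  assumes "otree A"
  obtains l :: "'v \<Rightarrow> int" where "\<And>g. g \<in> A \<Longrightarrow> l (snd g) - l (fst g) = 1"
proof
  define l :: "'v \<Rightarrow> int" where "l v = (\<Sum>g\<in>A. of_bool (v \<in> head_side A g))" for v
  fix g assume g: "g \<in> A"
  have "l (snd g) - l (fst g) = (\<Sum>g'\<in>A. of_bool (g = g'))"
    unfolding l_def sum_subtractf[symmetric]
    using assms g by (intro sum.cong refl) (simp add: head_side_diff)
  then show "l (snd g) - l (fst g) = 1"
    using g by (simp add: of_bool_def cong: if_cong)
qed

section \<open>Exchanging an arc of a tree\<close>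

lemma underlying_exchange:
  fixes A :: "('v::finite \<times> 'v) set"
  assumes "otree A" "f \<in> A"
  shows "underlying (insert (u, v) (A - {f})) = insert {u, v} (underlying A - {{fst f, snd f}})"
proof -
  have "inj_on (\<lambda>g. {fst g, snd g}) A"
    using otree_arc_eq[OF assms(1)] by (intro inj_onI) blast
  then have "underlying (A - {f}) = underlying A - {{fst f, snd f}}"
    unfolding underlying_image using assms(2) inj_on_image_set_diff[of "\<lambda>g. {fst g, snd g}" A A "{f}"] by simp
  moreover have "underlying (insert (u, v) (A - {f})) = insert {u, v} (underlying (A - {f}))"
    unfolding underlying_image by simp
  ultimately show ?thesis by simp
qed

text \<open>\<open>(u, v)\<close> reconnects the two sides that the removal of \<open>f\<close>
  leaves. That an edge is a bridge is shown by a function that jumps along this edge only.\<close>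

lemma otree_exchange:
  fixes A :: "('v::finite \<times> 'v) set"
  assumes A: "otree A" and f: "f \<in> A"
    and new: "{u, v} \<notin> underlying A" and u: "u \<notin> head_side A f" and v: "v \<in> head_side A f"
  shows "otree (insert (u, v) (A - {f}))"
proof -
  let ?T = "underlying A"
  let ?A = "insert (u, v) (A - {f})"
  let ?T' = "underlying ?A"
  let ?e = "{fst f, snd f}"
  have T': "?T' = insert {u, v} (?T - {?e})" by (rule underlying_exchange[OF A f])
  have sub: "?T - {?e} \<subseteq> ?T'" using T' by blast
  have "connected_graph ?T'"
  proof -
    have uf: "same_component ?T' u (fst f)"
      using same_component_tail_side[OF A f u] sub by (meson same_component_mono same_component_sym)
    have vf: "same_component ?T' v (snd f)"
      using v sub unfolding head_side_def by (metis mem_Collect_eq same_component_mono same_component_sym)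
    have uv: "same_component ?T' u v" using T' by (auto intro: same_component_edge)
    have "same_component ?T' u w" for w
    proof (cases "w \<in> head_side A f")
      case True
      then have "same_component ?T' (snd f) w"
        using sub same_component_mono by (fastforce simp: head_side_def)
      then show ?thesis using uv vf by (blast intro: same_component_trans)
    next
      case False
      then have "same_component ?T' (fst f) w"
        using same_component_tail_side[OF A f] sub by (blast intro: same_component_mono)
      then show ?thesis using uf by (blast intro: same_component_trans)
    qed
    then show ?thesis
      unfolding connected_graph_def by (meson same_component_sym same_component_trans)
  qed
  moreover have "\<not> same_component (?T' - {{a, b}}) a b" if ab: "{a, b} \<in> ?T'" for a b
  proof (cases "{a, b} = {u, v}")
    case True
    have "\<not> same_component (?T' - {{a, b}}) u v"
    proof
      assume "same_component (?T' - {{a, b}}) u v"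
      then have "(u \<in> head_side A f) = (v \<in> head_side A f)"
        by (rule same_component_const) (use T' True in \<open>auto intro!: head_side_edge\<close>)
      then show False using u v by simp
    qed
    then show ?thesis using True same_component_sym by (metis doubleton_eq_iff)
  next
    case False
    then have "{a, b} \<in> ?T" "{a, b} \<noteq> ?e" using ab T' by auto
    then obtain g where g: "g \<in> A" "{a, b} = {fst g, snd g}" "g \<noteq> f"
      by (metis fst_conv snd_conv underlyingE)
    define \<phi> \<psi> where "\<phi> w = (of_bool (w \<in> head_side A g) :: int)"
      and "\<psi> w = (of_bool (w \<in> head_side A f) :: int)" for w
    \<comment> \<open>The indicator of the head side of \<open>g\<close>, corrected by that of
      \<open>f\<close> so that it agrees at \<open>u\<close> and \<open>v\<close>. A jump along
      \<open>f\<close> does no harm, as \<open>f\<close> is gone; what remains is the jump along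
      \<open>g\<close>.\<close>
    define \<theta> where "\<theta> w = \<phi> w - (\<phi> v - \<phi> u) * \<psi> w" for w
    show ?thesis
    proof
      assume "same_component (?T' - {{a, b}}) a b"
      then have "\<theta> a = \<theta> b"
      proof (rule same_component_const)
        fix c d assume cd: "{c, d} \<in> ?T' - {{a, b}}"
        show "\<theta> c = \<theta> d"
        proof (cases "{c, d} = {u, v}")
          case True
          have "\<theta> u = \<theta> v" using u v by (simp add: \<theta>_def \<psi>_def)
          then show ?thesis using True by (auto simp: doubleton_eq_iff)
        next
          case False
          then have "{c, d} \<in> ?T" "{c, d} \<noteq> ?e" "{c, d} \<noteq> {fst g, snd g}"
            using cd T' g by auto
          then show ?thesis
            using head_side_edge[of c d A f] head_side_edge[of c d A g]
            by (simp add: \<theta>_def \<phi>_def \<psi>_def)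
        qed
      qed
      then have "\<theta> (fst g) = \<theta> (snd g)" using g(2) by (auto simp: doubleton_eq_iff)
      moreover have "\<psi> (fst g) = \<psi> (snd g)"
        using head_side_arc[OF A f g(1,3)] by (simp add: \<psi>_def)
      ultimately show False
        using fst_notin_head_side[OF A g(1)] snd_in_head_side[of g A] by (simp add: \<theta>_def \<phi>_def)
    qed
  qed
  moreover have "\<forall>t h. (t, h) \<in> ?A \<longrightarrow> (h, t) \<notin> ?A"
  proof (intro allI impI notI)
    fix t h assume th: "(t, h) \<in> ?A" "(h, t) \<in> ?A"
    have "u \<noteq> v" using u v by blast
    moreover have "(u, v) \<notin> A" "(v, u) \<notin> A" using new by (auto simp: underlying_iff)
    ultimately show False using th A by (auto simp: otree_def)
  qed
  ultimately show ?thesis unfolding otree_def tree_def by blast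
qed

text \<open>A simplex pivot: the arc \<open>(u, v)\<close> enters, and \<open>\<delta>\<close> units of flow are rerouted through it.\<close>

lemma pivot:
  fixes A :: "('v::finite \<times> 'v) set"
  assumes y: "generic y" and A: "otree A" and pos: "positive A y"
    and new: "{u, v} \<notin> underlying A"
    and l: "\<And>g. g \<in> A \<Longrightarrow> l (snd g) - l (fst g) = 1" and uv: "l u < l v"
  obtains f \<delta> where "f \<in> A" "u \<notin> head_side A f" "v \<in> head_side A f" "\<delta> > 0"
    "otree (insert (u, v) (A - {f}))" "positive (insert (u, v) (A - {f})) y"
    "(\<Sum>g\<in>insert (u, v) (A - {f}). cut (insert (u, v) (A - {f})) y g) =
       (\<Sum>g\<in>A. cut A y g) + \<delta> * (1 - (l v - l u))"
proof -
  \<comment> \<open>\<open>s\<close> encodes the tree path from \<open>u\<close> to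
    \<open>v\<close>: 1 on arcs crossed forwards, -1 on arcs crossed backwards, 0 elsewhere.\<close>
  define s where "s g = (of_bool (v \<in> head_side A g) - of_bool (u \<in> head_side A g) :: int)" for g
  have s1: "s g = 1 \<longleftrightarrow> u \<notin> head_side A g \<and> v \<in> head_side A g" for g by (simp add: s_def)
  have s: "\<phi> v - \<phi> u = (\<Sum>g\<in>A. s g * (\<phi> (snd g) - \<phi> (fst g)))" for \<phi> :: "'v \<Rightarrow> int"
    by (subst potential_diff[OF A]) (simp add: s_def mult.commute)
  have sum_s: "(\<Sum>g\<in>A. s g) = l v - l u"
    by (subst s) (simp add: l)
  \<comment> \<open>\<open>l\<close> rises by 1 along every arc, so a path with positive total rise
    crosses some arc forwards; only such arcs lose flow and can leave.\<close>
  have "\<exists>g\<in>A. s g > 0"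
    using sum_nonpos[of A s] sum_s uv by force
  then have ne: "{g\<in>A. s g = 1} \<noteq> {}"
    by (auto simp: s_def split: if_splits)
  \<comment> \<open>The ratio test: \<open>f\<close> has the least flow among the arcs that lose
    flow, so rerouting all of it keeps the others nonnegative.\<close>
  define f where "f = arg_min_on (cut A y) {g\<in>A. s g = 1}"
  have "f \<in> {g\<in>A. s g = 1}"
    unfolding f_def by (rule arg_min_if_finite(1)[OF _ ne]) simp
  then have f: "f \<in> A" "s f = 1" by auto
  have f_min: "cut A y f \<le> cut A y g" if "g \<in> A" "s g = 1" for g
    unfolding f_def by (rule arg_min_least[OF _ ne]) (use that in auto)
  define \<delta> where "\<delta> = cut A y f"
  have \<delta>: "\<delta> > 0" using pos f by (simp add: \<delta>_def positive_def)
  define A' where "A' = insert (u, v) (A - {f})"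
  define c where "c g = (if g = (u, v) then \<delta> else cut A y g - \<delta> * s g)" for g
  have uvA: "(u, v) \<notin> A" using new by (simp add: underlying_iff)
  have sum_A': "(\<Sum>g\<in>A'. c g * k g) = \<delta> * k (u, v) + (\<Sum>g\<in>A. (cut A y g - \<delta> * s g) * k g)"
    for k :: "'v \<times> 'v \<Rightarrow> int"
  proof -
    have "(\<Sum>g\<in>A'. c g * k g) = \<delta> * k (u, v) + (\<Sum>g\<in>A - {f}. c g * k g)"
      using uvA by (simp add: A'_def c_def)
    also have "(\<Sum>g\<in>A - {f}. c g * k g) = (\<Sum>g\<in>A - {f}. (cut A y g - \<delta> * s g) * k g)"
      using uvA by (intro sum.cong) (auto simp: c_def)
    \<comment> \<open>The leaving arc can be added back, since its new coefficient is 0.\<close>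
    also have "\<dots> = (\<Sum>g\<in>A. (cut A y g - \<delta> * s g) * k g)"
      using f by (intro sum.mono_neutral_left) (auto simp: \<delta>_def)
    finally show ?thesis .
  qed
  have tree': "otree A'"
    unfolding A'_def using f s1[of f] by (intro otree_exchange[OF A _ new]) auto
  have flow': "flow A' c y"
    unfolding flow_def
  proof
    fix \<phi> :: "'v \<Rightarrow> int"
    have "(\<Sum>v\<in>UNIV. \<phi> v * y v) = (\<Sum>g\<in>A. cut A y g * (\<phi> (snd g) - \<phi> (fst g)))"
      using flow_cut[OF A] y by (simp add: flow_def generic_def)
    also have "\<dots> = \<delta> * (\<phi> v - \<phi> u) + (\<Sum>g\<in>A. (cut A y g - \<delta> * s g) * (\<phi> (snd g) - \<phi> (fst g)))"
      unfolding s[of \<phi>] by (simp add: left_diff_distrib sum_subtractf sum_distrib_left mult.assoc)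
    also have "\<dots> = (\<Sum>g\<in>A'. c g * (\<phi> (snd g) - \<phi> (fst g)))"
      by (simp add: sum_A')
    finally show "(\<Sum>v\<in>UNIV. \<phi> v * y v) = (\<Sum>g\<in>A'. c g * (\<phi> (snd g) - \<phi> (fst g)))" .
  qed
  have "c g \<ge> 0" if "g \<in> A'" for g
  proof (cases "g = (u, v)")
    case False
    then have g: "g \<in> A" using that by (simp add: A'_def)
    have "s g = 1 \<or> s g \<le> 0" by (auto simp: s_def)
    then have "\<delta> * s g \<le> cut A y g"
    proof
      assume "s g \<le> 0"
      then have "\<delta> * s g \<le> 0" using \<delta> by (simp add: mult_nonneg_nonpos)
      also have "0 \<le> cut A y g" using pos g by (simp add: positive_def less_imp_le)
      finally show ?thesis .
    qed (use f_min[OF g] in \<open>simp add: \<delta>_def\<close>)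
    then show ?thesis using False by (simp add: c_def)
  qed (use \<delta> in \<open>simp add: c_def\<close>)
  then have "positive A' y"
    using flow' positive_iff_flow[OF y tree'] by blast
  \<comment> \<open>\<open>1 - (l v - l u)\<close> is the reduced cost of \<open>(u, v)\<close>: the
    new arc costs 1, and the path it replaces costs \<open>l v - l u\<close> net.\<close>
  moreover have "(\<Sum>g\<in>A'. cut A' y g) = (\<Sum>g\<in>A. cut A y g) + \<delta> * (1 - (l v - l u))"
  proof -
    have "(\<Sum>g\<in>A'. cut A' y g) = (\<Sum>g\<in>A'. c g)"
      by (intro sum.cong refl) (simp add: flow_unique[OF tree' flow'])
    also have "\<dots> = \<delta> + (\<Sum>g\<in>A. cut A y g - \<delta> * s g)"
      using sum_A'[of "\<lambda>_. 1"] by simp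
    also have "\<dots> = (\<Sum>g\<in>A. cut A y g) + \<delta> * (1 - (l v - l u))"
      by (simp add: sum_subtractf algebra_simps sum_s flip: sum_distrib_left)
    finally show ?thesis .
  qed
  ultimately show ?thesis
    using that[of f \<delta>] f s1[of f] \<delta> tree' by (auto simp: A'_def)
qed

section \<open>Facets met by a generic direction\<close>

lemma layer_edges_facet:
  "A \<subseteq> facet_graph E l \<Longrightarrow> underlying A \<subseteq> layer_edges E l"
  by (auto simp: facet_graph_def underlying_def)

lemma layer_edges_iff: "{u, v} \<in> layer_edges E l \<longleftrightarrow> {u, v} \<in> E \<and> \<bar>l u - l v\<bar> = 1"
  unfolding layer_edges_def mem_Collect_eq
  by (metis (no_types, opaque_lifting) abs_minus_commute doubleton_eq_iff)

lemma facet_graph_iff: "(u, v) \<in> facet_graph E l \<longleftrightarrow> {u, v} \<in> E \<and> l v - l u = 1"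
  by (auto simp: facet_graph_def layer_edges_iff)

lemma underlying_facet_graph: "underlying (facet_graph E l) = layer_edges E l"
proof
  show "layer_edges E l \<subseteq> underlying (facet_graph E l)"
  proof
    fix e assume "e \<in> layer_edges E l"
    then obtain u v where uv: "e = {u, v}" "{u, v} \<in> E" "\<bar>l u - l v\<bar> = 1"
      by (auto simp: layer_edges_def)
    then have "l v - l u = 1 \<or> l u - l v = 1" by linarith
    then show "e \<in> underlying (facet_graph E l)"
      using uv by (auto simp: underlying_iff facet_graph_iff insert_commute)
  qed
qed (rule layer_edges_facet[OF subset_refl])

text \<open>Any spanning tree will do: every edge is oriented towards the side whose demand is
  positive. Genericity provides exactly one such side.\<close>

lemma exists_positive_otree:
  fixes E :: "'v::finite set set"
  assumes E: "simple_graph E" "connected_graph E" and y: "generic y"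
  obtains A where "otree A" "underlying A \<subseteq> E" "positive A y"
proof -
  obtain T where T: "T \<subseteq> E" "tree T" using connected_imp_tree[OF E(2)] .
  define H where "H t h = {w. same_component (T - {{t, h}}) h w}" for t h
  define A where "A = {(t, h). {t, h} \<in> T \<and> (\<Sum>w\<in>H t h. y w) > 0}"
  have H: "(\<Sum>w\<in>H t h. y w) = - (\<Sum>w\<in>H h t. y w) \<and> (\<Sum>w\<in>H t h. y w) \<noteq> 0" if "{t, h} \<in> T" for t h
  proof -
    have "H t h = - H h t"
      unfolding H_def using tree_sides[OF T(2) that] by (simp add: insert_commute)
    moreover have "(\<Sum>w\<in>H h t. y w) + (\<Sum>w\<in>- H h t. y w) = (\<Sum>w\<in>UNIV. y w)"
      by (subst sum.union_disjoint[symmetric]) (auto simp: Compl_partition)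
    moreover have "h \<in> H t h" "t \<in> H h t" by (simp_all add: H_def)
    ultimately show ?thesis using y by (auto simp: generic_def)
  qed
  have "underlying A = T"
  proof
    show "T \<subseteq> underlying A"
    proof
      fix e assume e: "e \<in> T"
      then have "card e = 2" using T E by (auto simp: simple_graph_def)
      then obtain t h where th: "e = {t, h}" by (auto simp: card_2_iff)
      have "(t, h) \<in> A \<or> (h, t) \<in> A"
        using H[of t h] e th by (auto simp: A_def insert_commute)
      then show "e \<in> underlying A" using th by (simp add: underlying_iff)
    qed
  qed (auto simp: A_def underlying_def)
  moreover have "(h, t) \<notin> A" if "(t, h) \<in> A" for t h
    using H[of t h] that by (auto simp: A_def)
  moreover have "positive A y"
    using \<open>underlying A = T\<close> by (auto simp: positive_def cut_def head_side_def A_def H_def)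
  ultimately show ?thesis
    using that[of A] T by (auto simp: otree_def)
qed

text \<open>A positive tree of minimal cost is optimal among all flows, so its potential is dual feasible.\<close>

lemma exists_facet:
  fixes E :: "'v::finite set set"
  assumes E: "simple_graph E" "connected_graph E" and y: "generic y"
  obtains A l where "otree A" "positive A y" "layering E l" "A \<subseteq> facet_graph E l"
proof -
  \<comment> \<open>With unit cost per arc, dual feasibility bounds the rise of the potential along
    each edge by 1.\<close>
  define cost where "cost A = (\<Sum>g\<in>A. cut A y g)" for A
  let ?P = "{A. otree A \<and> underlying A \<subseteq> E \<and> positive A y}"
  obtain A0 where "otree A0" "underlying A0 \<subseteq> E" "positive A0 y"
    using exists_positive_otree[OF E y] .
  then have ne: "?P \<noteq> {}" by blast
  define A where "A = arg_min_on cost ?P"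
  have "A \<in> ?P"
    unfolding A_def by (rule arg_min_if_finite(1)[OF _ ne]) simp
  then have A: "otree A" "underlying A \<subseteq> E" "positive A y" by auto
  have min: "cost A \<le> cost A'" if "A' \<in> ?P" for A'
    unfolding A_def by (rule arg_min_least[OF _ ne that]) simp
  obtain l :: "'v \<Rightarrow> int" where l: "\<And>g. g \<in> A \<Longrightarrow> l (snd g) - l (fst g) = 1"
    using otree_potential[OF A(1)] by blast
  have sub: "A \<subseteq> facet_graph E l"
  proof
    fix g assume "g \<in> A"
    then show "g \<in> facet_graph E l"
      using l[of g] A(2) by (cases g) (auto simp: facet_graph_iff underlying_iff)
  qed
  \<comment> \<open>An edge with a larger rise has negative reduced cost, so pivoting it in would
    beat the minimum.\<close>
  have le: "l v - l u \<le> 1" if uv: "{u, v} \<in> E" for u v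
  proof (rule ccontr)
    assume "\<not> l v - l u \<le> 1"
    then have gt: "l v - l u > 1" by simp
    have new: "{u, v} \<notin> underlying A"
      using gt l[of "(u, v)"] l[of "(v, u)"] by (auto simp: underlying_iff)
    have lt: "l u < l v" using gt by simp
    from pivot[OF y A(1,3) new l lt] obtain f \<delta> where f: "f \<in> A" "\<delta> > 0"
      and A': "otree (insert (u, v) (A - {f}))" "positive (insert (u, v) (A - {f})) y"
      "cost (insert (u, v) (A - {f})) = cost A + \<delta> * (1 - (l v - l u))"
      unfolding cost_def by metis
    have "insert (u, v) (A - {f}) \<in> ?P"
      using A' A(2) uv underlying_exchange[OF A(1) f(1)] by auto
    then have "\<delta> * (1 - (l v - l u)) \<ge> 0" using min A'(3) by force
    then show False using f(2) gt by (simp add: zero_le_mult_iff)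
  qed
  have "\<bar>l u - l v\<bar> \<le> 1" if "{u, v} \<in> E" for u v
    using le[of u v] le[of v u] that by (simp add: insert_commute abs_le_iff)
  moreover have "connected_graph (layer_edges E l)"
    using otree_connected[OF A(1)] layer_edges_facet[OF sub]
    unfolding connected_graph_def by (blast intro: same_component_mono)
  ultimately show ?thesis
    using that A sub by (auto simp: layering_def)
qed

text \<open>Complementary slackness. Each of \<open>l\<close> and \<open>l'\<close> maximizes the
  pairing with \<open>y\<close> among layerings, as its own tree is tight for it. Equal maxima force
  the tree of one to be tight for the other, and two potentials with the same jumps on a spanning
  tree differ by a constant.\<close>

lemma facet_unique:
  fixes E :: "'v::finite set set"
  assumes y: "generic y" and A: "otree A" "positive A y" "A \<subseteq> facet_graph E l" and l: "layering E l"
    and A': "otree A'" "positive A' y" "A' \<subseteq> facet_graph E l'" and l': "layering E l'"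
  shows "facet_graph E l = facet_graph E l'"
proof -
  have bound: "(\<Sum>v\<in>UNIV. l' v * y v) \<le> (\<Sum>v\<in>UNIV. l v * y v) \<and>
    ((\<Sum>v\<in>UNIV. l' v * y v) = (\<Sum>v\<in>UNIV. l v * y v) \<longrightarrow>
      (\<forall>g\<in>A. l' (snd g) - l' (fst g) = 1))"
    if A: "otree A" "positive A y" "A \<subseteq> facet_graph E l" and l': "layering E l'"
    for l l' and A :: "('v \<times> 'v) set"
  proof -
    have fl: "(\<Sum>v\<in>UNIV. \<phi> v * y v) = (\<Sum>g\<in>A. cut A y g * (\<phi> (snd g) - \<phi> (fst g)))" for \<phi>
      using flow_cut[OF A(1)] y by (simp add: flow_def generic_def)
    have g: "l (snd g) - l (fst g) = 1" "l' (snd g) - l' (fst g) \<le> 1" "cut A y g > 0"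
      if "g \<in> A" for g
    proof -
      have "(fst g, snd g) \<in> facet_graph E l" using that A(3) by auto
      then show "l (snd g) - l (fst g) = 1" "l' (snd g) - l' (fst g) \<le> 1"
        using l' unfolding facet_graph_iff layering_def by (auto simp: abs_le_iff)
    qed (use that A(2) in \<open>simp add: positive_def\<close>)
    have le: "cut A y g * (l' (snd g) - l' (fst g)) \<le> cut A y g * (l (snd g) - l (fst g))"
      if "g \<in> A" for g
      using g[OF that] by (intro mult_left_mono) auto
    have "(\<Sum>v\<in>UNIV. l' v * y v) \<le> (\<Sum>v\<in>UNIV. l v * y v)"
      unfolding fl by (intro sum_mono le)
    moreover have "l' (snd g) - l' (fst g) = 1"
      if "(\<Sum>v\<in>UNIV. l' v * y v) = (\<Sum>v\<in>UNIV. l v * y v)" "g \<in> A" for g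
    proof -
      have "cut A y g * (l' (snd g) - l' (fst g)) = cut A y g * (l (snd g) - l (fst g))"
        using sum_mono_inv[of _ A, OF that(1)[unfolded fl] le that(2)] by simp
      then show ?thesis using g[OF that(2)] by simp
    qed
    ultimately show ?thesis by blast
  qed
  have tight: "l' (snd g) - l' (fst g) = 1" if "g \<in> A" for g
    using bound[OF A l'] bound[OF A' l] that by force
  have "l' u - l u = l' v - l v" for u v
  proof (rule connected_const[OF otree_connected[OF A(1)]])
    fix g assume g: "g \<in> A"
    then have "(fst g, snd g) \<in> facet_graph E l" using A(3) by auto
    then show "l' (fst g) - l (fst g) = l' (snd g) - l (snd g)"
      using tight[OF g] unfolding facet_graph_iff by linarith
  qed
  then have "l' v - l' u = l v - l u" for u v by (metis add.commute diff_add_cancel diff_diff_eq2)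
  then show ?thesis by (auto simp: facet_graph_iff)
qed

section \<open>Tours of spanning trees\<close>

lemma other_end_eq [simp]: "other_end x {x, y} = y"
  unfolding other_end_def by (rule the_equality) (auto simp: doubleton_eq_iff)

lemma other_end_eq' [simp]: "other_end y {x, y} = x"
  using other_end_eq[of y x] by (simp only: insert_commute)

lemma cyclic_on_inj_on:
  assumes "cyclic_on f S"
  shows "inj_on f S"
proof -
  have "y \<in> f ` S" if y: "y \<in> S" for y
  proof -
    have "y \<in> orbit f y" using assms y by (auto simp: cyclic_on_alldef)
    then obtain n where n: "y = (f ^^ n) y" "0 < n" by (auto simp: orbit_altdef)
    then have "y = f ((f ^^ (n - 1)) y)" by (metis Suc_pred' comp_apply funpow.simps(2))
    then show ?thesis using cyclic_on_funpow_in[OF assms y] by blast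
  qed
  then have "S \<subseteq> f ` S" by blast
  then show ?thesis using finite_cyclic_on[OF assms] by (rule finite_surj_inj[rotated])
qed

text \<open>A discrete intermediate value principle, applied to the side of a cut on which the tour
  stands.\<close>

lemma leaves_set:
  fixes n m :: nat
  assumes "n \<le> m" "P n" "\<not> P m"
  obtains k where "n \<le> k" "k < m" "P k" "\<not> P (Suc k)"
proof -
  have "\<exists>k. n \<le> k \<and> k < m \<and> P k \<and> \<not> P (Suc k)"
    using assms
  proof (induction m rule: dec_induct)
    case (step m)
    then show ?case by (cases "P m") (auto intro: less_SucI)
  qed simp
  then show ?thesis using that by blast
qed

definition darts :: "'v set set \<Rightarrow> ('v \<times> 'v set) set" where
  "darts F = {(x, e). e \<in> F \<and> x \<in> e}"

locale toured_tree =
  fixes F :: "'v::finite set set" and rib :: "'v \<Rightarrow> 'v set \<Rightarrow> 'v set"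
    and b0 :: 'v and e0 :: "'v set" and T :: "'v set set"
  assumes F: "simple_graph F"
    and rib: "\<And>x. incident_edges F x \<noteq> {} \<Longrightarrow> cyclic_on (rib x) (incident_edges F x)"
    and e0: "e0 \<in> F" "b0 \<in> e0"
    and T: "T \<subseteq> F" "tree T"
begin

text \<open>The tour continued forever; the actual tour is its first \<open>period\<close>
  terms.\<close>

definition "\<tau> n = (tour_step rib T ^^ n) (b0, e0)"

lemma tour_0 [simp]: "\<tau> 0 = (b0, e0)" and tour_Suc: "\<tau> (Suc n) = tour_step rib T (\<tau> n)"
  by (simp_all add: \<tau>_def)

definition "period = (LEAST n. 0 < n \<and> \<tau> n = (b0, e0))"

lemma other_end_mem:
  assumes "e \<in> F" "x \<in> e"
  shows "e = {x, other_end x e}" "other_end x e \<noteq> x"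
proof -
  have "card e = 2" using assms F by (auto simp: simple_graph_def)
  then obtain a b where e: "e = {a, b}" "a \<noteq> b" by (auto simp: card_2_iff)
  have "x = a \<or> x = b" using assms(2) e(1) by simp
  then show "e = {x, other_end x e}" "other_end x e \<noteq> x"
    using e by auto
qed

lemma other_end_in: "e \<in> F \<Longrightarrow> x \<in> e \<Longrightarrow> other_end x e \<in> e"
  using other_end_mem(1)[of e x] by (metis insertCI)

lemma rib_mem: "e \<in> F \<Longrightarrow> x \<in> e \<Longrightarrow> rib x e \<in> F \<and> x \<in> rib x e"
proof -
  assume "e \<in> F" "x \<in> e"
  then have e: "e \<in> incident_edges F x" by (simp add: incident_edges_def)
  then have "cyclic_on (rib x) (incident_edges F x)" using rib by blast
  then have "rib x e \<in> incident_edges F x" using e by (rule cyclic_on_inI)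
  then show ?thesis by (simp add: incident_edges_def)
qed

lemma rib_inj:
  assumes "e \<in> F" "x \<in> e" "e' \<in> F" "x \<in> e'" "rib x e = rib x e'"
  shows "e = e'"
proof -
  have e: "e \<in> incident_edges F x" "e' \<in> incident_edges F x"
    using assms by (simp_all add: incident_edges_def)
  then have "inj_on (rib x) (incident_edges F x)" using rib cyclic_on_inj_on by blast
  then show ?thesis using e assms(5) by (simp add: inj_on_def)
qed

lemma step_in: "e \<in> T \<Longrightarrow> tour_step rib T (x, e) = (other_end x e, rib (other_end x e) e)"
  and step_out: "e \<notin> T \<Longrightarrow> tour_step rib T (x, e) = (x, rib x e)"
  by (simp_all add: tour_step_def)

lemma step_darts: "p \<in> darts F \<Longrightarrow> tour_step rib T p \<in> darts F"
  using rib_mem other_end_in by (cases p) (auto simp: darts_def tour_step_def)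

text \<open>A step can be undone: the ribbon permutation at the new vertex recovers the edge, and
  the edge recovers the old vertex. Hence the sequence is purely periodic and the first pair to
  recur is the basis.\<close>

lemma step_inj: "inj_on (tour_step rib T) (darts F)"
proof (rule inj_onI)
  fix p q assume "p \<in> darts F" "q \<in> darts F" and eq: "tour_step rib T p = tour_step rib T q"
  then obtain x e y e' where p: "p = (x, e)" "e \<in> F" "x \<in> e" and q: "q = (y, e')" "e' \<in> F" "y \<in> e'"
    by (auto simp: darts_def)
  define x' where "x' = (if e \<in> T then other_end x e else x)"
  define y' where "y' = (if e' \<in> T then other_end y e' else y)"
  have "tour_step rib T p = (x', rib x' e)" "tour_step rib T q = (y', rib y' e')"
    by (simp_all add: p q tour_step_def x'_def y'_def)
  then have xy: "x' = y'" "rib x' e = rib x' e'" using eq by auto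
  have "x' \<in> e" "y' \<in> e'"
    using other_end_mem(1)[OF p(2,3)] other_end_mem(1)[OF q(2,3)] p q by (auto simp: x'_def y'_def)
  then have "e = e'" using xy rib_inj p q by metis
  moreover have "x = y"
    using xy(1) \<open>e = e'\<close> other_end_mem(1)[OF p(2,3)] other_end_mem(1)[OF q(2,3)]
    unfolding x'_def y'_def by (metis doubleton_eq_iff)
  ultimately show "p = q" using p q by simp
qed

lemma tour_darts: "\<tau> n \<in> darts F"
proof (induction n)
  case 0
  then show ?case using e0 by (simp add: darts_def)
next
  case (Suc n)
  then show ?case unfolding tour_Suc by (rule step_darts)
qed

lemma tour_edge: "snd (\<tau> n) \<in> F" "fst (\<tau> n) \<in> snd (\<tau> n)"
  using tour_darts[of n] by (auto simp: darts_def)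

lemma tour_cancel: "\<tau> i = \<tau> (i + k) \<Longrightarrow> \<tau> k = (b0, e0)"
proof (induction i)
  case (Suc i)
  then have "\<tau> i = \<tau> (i + k)"
    using inj_onD[OF step_inj _ tour_darts tour_darts] by (simp add: tour_Suc)
  then show ?case by (rule Suc.IH)
qed simp

lemma period: "0 < period" "\<tau> period = (b0, e0)"
proof -
  have "\<exists>i j. i < j \<and> \<tau> i = \<tau> j"
  proof (rule ccontr)
    assume "\<nexists>i j. i < j \<and> \<tau> i = \<tau> j"
    then have "i = j" if "\<tau> i = \<tau> j" for i j
      using that by (cases i j rule: linorder_cases) (blast, simp, metis)
    then have "inj \<tau>" by (rule injI)
    then show False using finite_imageD[of "\<lambda>n. \<tau> n" UNIV] by simp
  qed
  then obtain i j where ij: "i < j" "\<tau> i = \<tau> j" by blast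
  then have "\<tau> i = \<tau> (i + (j - i))" by simp
  then have "\<tau> (j - i) = (b0, e0)" by (rule tour_cancel)
  then have "0 < j - i \<and> \<tau> (j - i) = (b0, e0)" using ij(1) by simp
  then have "0 < period \<and> \<tau> period = (b0, e0)" unfolding period_def by (rule LeastI)
  then show "0 < period" "\<tau> period = (b0, e0)" by auto
qed

lemma tour_distinct:
  assumes "i < period" "j < period" "\<tau> i = \<tau> j"
  shows "i = j"
proof -
  have "\<not> i < j" if "j < period" "\<tau> i = \<tau> j" for i j
  proof
    assume "i < j"
    then have "\<tau> i = \<tau> (i + (j - i))" using that by simp
    then have "\<tau> (j - i) = (b0, e0)" by (rule tour_cancel)
    then have "period \<le> j - i" unfolding period_def using \<open>i < j\<close> by (intro Least_le) simp
    then show False using that(1) \<open>i < j\<close> by simp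
  qed
  then show ?thesis using assms by (metis linorder_neqE_nat)
qed

lemma tour_mod: "\<tau> (n mod period) = \<tau> n"
  unfolding \<tau>_def by (rule funpow_mod_eq) (use period in \<open>simp add: \<tau>_def\<close>)

lemma tour_Suc_fst:
  "fst (\<tau> (Suc n)) = (if snd (\<tau> n) \<in> T then other_end (fst (\<tau> n)) (snd (\<tau> n)) else fst (\<tau> n))"
  by (cases "\<tau> n") (simp add: tour_Suc tour_step_def)

text \<open>The tour changes its vertex only along edges of \<open>T\<close>, and all of these
  except \<open>f\<close> stay on one side of \<open>S\<close>.\<close>

lemma crossing_edge:
  assumes S: "\<And>a b. {a, b} \<in> T \<Longrightarrow> {a, b} \<noteq> f \<Longrightarrow> (a \<in> S \<longleftrightarrow> b \<in> S)"
    and "fst (\<tau> n) \<in> S \<longleftrightarrow> fst (\<tau> (Suc n)) \<notin> S"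
  shows "snd (\<tau> n) = f"
proof -
  let ?x = "fst (\<tau> n)" and ?e = "snd (\<tau> n)"
  have e: "?e = {?x, other_end ?x ?e}" using other_end_mem(1) tour_edge by blast
  have "?e \<in> T" using assms(2) tour_Suc_fst by metis
  then have "fst (\<tau> (Suc n)) = other_end ?x ?e" by (simp add: tour_Suc_fst)
  then show ?thesis
    using S[of ?x "other_end ?x ?e"] assms(2) e \<open>?e \<in> T\<close> by metis
qed

lemma component_edge:
  assumes "{a, b} \<in> T" "{a, b} \<noteq> f"
  shows "a \<in> {w. same_component (T - {f}) r w} \<longleftrightarrow> b \<in> {w. same_component (T - {f}) r w}"
proof -
  have "same_component (T - {f}) a b" using assms by (intro same_component_edge) auto
  then show ?thesis by (auto simp: mem_Collect_eq) (meson same_component_sym same_component_trans)+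
qed

text \<open>Crossing \<open>e\<close> from \<open>x\<close> leaves the component of \<open>x\<close>
  in \<open>T - {e}\<close>. By periodicity the tour comes back there, and only \<open>e\<close>
  leads back.\<close>

lemma tour_returns:
  assumes "\<tau> n = (x, e)" "e \<in> T"
  obtains m where "\<tau> m = (other_end x e, e)"
proof -
  define z where "z = other_end x e"
  have "(x, e) \<in> darts F" using tour_darts[of n] assms(1) by simp
  then have e: "e = {x, z}" "x \<noteq> z" using other_end_mem[of e x] by (auto simp: darts_def z_def)
  define S where "S = {w. same_component (T - {e}) x w}"
  have "z \<notin> S" using T(2) assms(2) e by (auto simp: S_def tree_def)
  have "x \<in> S" by (simp add: S_def)
  have "fst (\<tau> (Suc n)) = z" using assms tour_Suc_fst[of n] by (simp add: z_def)
  then have start: "fst (\<tau> (Suc n)) \<notin> S" using \<open>z \<notin> S\<close> by simp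
  have "\<tau> (n + period) = \<tau> n" by (metis mod_add_self2 tour_mod)
  then have fin: "\<not> fst (\<tau> (n + period)) \<notin> S" using assms(1) \<open>x \<in> S\<close> by simp
  have "Suc n \<le> n + period" using period(1) by simp
  from leaves_set[of "Suc n" "n + period" "\<lambda>k. fst (\<tau> k) \<notin> S", OF this start fin]
  obtain k where k: "fst (\<tau> k) \<notin> S" "fst (\<tau> (Suc k)) \<in> S" by blast
  then have "snd (\<tau> k) = e"
    using crossing_edge[of e S k] component_edge[of _ _ e x] unfolding S_def by blast
  moreover have "fst (\<tau> k) = z"
    using tour_edge(2)[of k] calculation e k(1) \<open>x \<in> S\<close> by auto
  ultimately show ?thesis using that[of k] by (simp add: z_def prod_eq_iff)
qed

text \<open>An excursion along a tree edge ends with the return over that edge, after which the next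
  edge in cyclic order follows. So all edges at a visited vertex become current.\<close>

lemma tour_next_at:
  assumes "\<tau> n = (x, e)"
  obtains m where "\<tau> m = (x, rib x e)"
proof (cases "e \<in> T")
  case True
  obtain m where m: "\<tau> m = (other_end x e, e)" using tour_returns[OF assms True] .
  have "(x, e) \<in> darts F" using tour_darts[of n] assms by simp
  then have "other_end (other_end x e) e = x"
    using other_end_mem[of e x] by (auto simp: darts_def) (metis other_end_eq')
  then have "\<tau> (Suc m) = (x, rib x e)" using m step_in[OF True, of "other_end x e"] by (simp add: tour_Suc)
  then show ?thesis by (rule that)
next
  case False
  then have "\<tau> (Suc n) = (x, rib x e)" using assms step_out[OF False, of x] by (simp add: tour_Suc)
  then show ?thesis by (rule that)
qed

lemma tour_at_vertex:
  assumes "(x, e) \<in> range \<tau>" "e' \<in> F" "x \<in> e'"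
  shows "(x, e') \<in> range \<tau>"
proof -
  obtain n where "\<tau> n = (x, e)" using assms(1) by auto
  then have "e \<in> incident_edges F x"
    using tour_darts[of n] by (simp add: darts_def incident_edges_def)
  then have "orbit (rib x) e = incident_edges F x"
    using orbit_cyclic_eq3[OF rib, of x e] by auto
  then have "e' \<in> orbit (rib x) e" using assms by (simp add: incident_edges_def)
  then show ?thesis
  proof induction
    case base
    obtain m where "\<tau> m = (x, rib x e)" using tour_next_at[OF \<open>\<tau> n = (x, e)\<close>] .
    then show ?case by (metis rangeI)
  next
    case (step y)
    then obtain k where "\<tau> k = (x, y)" by auto
    then obtain m where "\<tau> m = (x, rib x y)" using tour_next_at by blast
    then show ?case by (metis rangeI)
  qed
qed

text \<open>Being fully visited spreads from \<open>b0\<close> along tree edges: a visited end makes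
  the edge current there, and \<open>tour_returns\<close> makes it current at the other end.\<close>

lemma tour_covers:
  assumes "p \<in> darts F"
  obtains i where "i < period" "\<tau> i = p"
proof -
  define vis where "vis x \<longleftrightarrow> ( \<forall>e. e \<in> F \<longrightarrow> x \<in> e \<longrightarrow> (x, e) \<in> range \<tau>)" for x
  have "(b0, e0) \<in> range \<tau>" using tour_0 by (metis rangeI)
  then have "vis b0" using tour_at_vertex unfolding vis_def by blast
  have "same_component T b0 (fst p)" using T(2) by (simp add: tree_def connected_graph_def)
  then have "vis b0 = vis (fst p)"
  proof (rule same_component_const)
    have step: "vis b" if ab: "{a, b} \<in> T" and vis: "vis a" for a b
    proof -
      have "{a, b} \<in> F" using ab T(1) by blast
      then have "(a, {a, b}) \<in> range \<tau>" using vis by (simp add: vis_def)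
      then obtain n where "\<tau> n = (a, {a, b})" by auto
      then obtain m where "\<tau> m = (b, {a, b})" using tour_returns[OF _ ab] by (metis other_end_eq)
      then have "(b, {a, b}) \<in> range \<tau>" by (metis rangeI)
      then show ?thesis using tour_at_vertex unfolding vis_def by blast
    qed
    then show "vis a = vis b" if "{a, b} \<in> T" for a b
      using that step[of a b] step[of b a] by (auto simp: insert_commute)
  qed
  then have "vis (fst p)" using \<open>vis b0\<close> by simp
  then have "p \<in> range \<tau>" using assms by (cases p) (simp add: darts_def vis_def)
  then obtain n where n: "p = \<tau> n" by blast
  show ?thesis
    using that[of "n mod period"] period(1) n tour_mod[of n] by simp
qed

text \<open>The length does not depend on the tree, so tours of different trees can be compared
  position by position.\<close>

lemma period_eq: "period = card (darts F)"
proof -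
  have "\<tau> ` {..<period} = darts F"
    using tour_darts tour_covers by (auto 0 3) (metis imageI lessThan_iff)
  moreover have "inj_on \<tau> {..<period}"
    using tour_distinct by (auto intro!: inj_onI)
  ultimately show ?thesis by (metis card_image card_lessThan)
qed

lemma current_before_iff:
  "current_before rib (b0, e0) T p q \<longleftrightarrow> (\<exists>i j. i < j \<and> j < period \<and> \<tau> i = p \<and> \<tau> j = q)"
proof -
  have "tour rib (b0, e0) T = map \<tau> [0..<period]"
    by (simp add: tour_def period_def \<tau>_def)
  then have "i < j \<and> j < length (tour rib (b0, e0) T) \<and>
      tour rib (b0, e0) T ! i = p \<and> tour rib (b0, e0) T ! j = q \<longleftrightarrow>
    i < j \<and> j < period \<and> \<tau> i = p \<and> \<tau> j = q" for i j
    by auto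
  then show ?thesis unfolding current_before_def by simp
qed

section \<open>Tours across fundamental cuts\<close>

lemma first_visit:
  assumes "\<And>k. k < m \<Longrightarrow> snd (\<tau> k) \<noteq> f"
  shows "same_component (T - {f}) b0 (fst (\<tau> m))"
proof (rule ccontr)
  let ?S = "{w. same_component (T - {f}) b0 w}"
  assume "\<not> ?thesis"
  then have m: "\<not> fst (\<tau> m) \<in> ?S" by simp
  have 0: "fst (\<tau> 0) \<in> ?S" by simp
  obtain k where k: "k < m" "fst (\<tau> k) \<in> ?S" "fst (\<tau> (Suc k)) \<notin> ?S"
    using leaves_set[of 0 m "\<lambda>k. fst (\<tau> k) \<in> ?S", OF le0 0 m] by blast
  have "snd (\<tau> k) = f"
    using k by (intro crossing_edge[of f ?S] component_edge) auto
  then show False using assms k(1) by blast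
qed

text \<open>The side of \<open>b0\<close> can be left only at the dart of \<open>f\<close> on that
  side, and this dart occurs once per period, namely at \<open>m\<close>. After its return the tour
  therefore stays.\<close>

lemma no_second_crossing:
  assumes "f \<in> T" "snd (\<tau> m) = f" "same_component (T - {f}) b0 (fst (\<tau> m))"
    and "m < i" "i \<le> j" "j < period" "same_component (T - {f}) b0 (fst (\<tau> i))"
  shows "same_component (T - {f}) b0 (fst (\<tau> j))"
proof (rule ccontr)
  let ?S = "{w. same_component (T - {f}) b0 w}"
  assume "\<not> ?thesis"
  then have j: "\<not> fst (\<tau> j) \<in> ?S" by simp
  have i: "fst (\<tau> i) \<in> ?S" using assms by simp
  obtain k where k: "i \<le> k" "k < j" "fst (\<tau> k) \<in> ?S" "fst (\<tau> (Suc k)) \<notin> ?S"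
    using leaves_set[of i j "\<lambda>k. fst (\<tau> k) \<in> ?S", OF assms(5) i j] by blast
  have kf: "snd (\<tau> k) = f"
    using k by (intro crossing_edge[of f ?S] component_edge) auto
  have "fst (\<tau> k) = fst (\<tau> m)"
  proof (rule ccontr)
    assume ne: "fst (\<tau> k) \<noteq> fst (\<tau> m)"
    have "card f = 2" using assms(1) T(1) F by (auto simp: simple_graph_def)
    then have "f = {fst (\<tau> k), fst (\<tau> m)}"
      using ne tour_edge(2)[of k] tour_edge(2)[of m] kf assms(2) by (auto simp: card_2_iff)
    then have "\<not> same_component (T - {f}) (fst (\<tau> k)) (fst (\<tau> m))"
      using T(2) assms(1) unfolding tree_def by blast
    then show False
      using k(3) assms(3) by (metis mem_Collect_eq same_component_sym same_component_trans)
  qed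
  then have "\<tau> k = \<tau> m" using kf assms(2) by (simp add: prod_eq_iff)
  then show False using tour_distinct[of k m] k assms by simp
qed

end

text \<open>A step consults the tree only to ask whether the current edge belongs to it.\<close>

lemma tours_agree:
  assumes "\<And>k. k < m \<Longrightarrow> snd ((tour_step rib T ^^ k) b) \<in> T \<longleftrightarrow> snd ((tour_step rib T ^^ k) b) \<in> T'"
    and "k \<le> m"
  shows "(tour_step rib T' ^^ k) b = (tour_step rib T ^^ k) b"
  using assms(2)
proof (induction k)
  case (Suc k)
  then show ?case
    using assms(1)[of k] by (cases "(tour_step rib T ^^ k) b") (simp add: tour_step_def)
qed simp

lemma tours_agree_all:
  assumes "toured_tree F rib b0 e0 T" "T' \<subseteq> F"
    and "\<And>k. k < card (darts F) \<Longrightarrow> snd ((tour_step rib T ^^ k) (b0, e0)) \<in> T \<longleftrightarrow>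
      snd ((tour_step rib T ^^ k) (b0, e0)) \<in> T'"
  shows "T = T'"
proof -
  interpret toured_tree F rib b0 e0 T by fact
  have "e \<in> T \<longleftrightarrow> e \<in> T'" if "e \<in> F" for e
  proof -
    have "card e = 2" using that F by (auto simp: simple_graph_def)
    then obtain x where "x \<in> e" by (auto simp: card_2_iff)
    then have "(x, e) \<in> darts F" using that by (simp add: darts_def)
    then obtain i where "i < period" "\<tau> i = (x, e)" by (rule tour_covers)
    then show ?thesis using assms(3)[of i] period_eq by (simp add: \<tau>_def)
  qed
  then show ?thesis using T(1) assms(2) by blast
qed

section \<open>Jaeger trees and generic directions\<close>

definition arcs :: "('v \<times> 'v) set \<Rightarrow> 'v set set \<Rightarrow> ('v \<times> 'v) set" where
  "arcs G T = {g \<in> G. {fst g, snd g} \<in> T}"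

lemma underlying_arcs: "T \<subseteq> underlying G \<Longrightarrow> underlying (arcs G T) = T"
  by (auto simp: underlying_image arcs_def)

lemma arcs_underlying:
  assumes "\<And>t h. (t, h) \<in> G \<Longrightarrow> (h, t) \<notin> G" "A \<subseteq> G"
  shows "arcs G (underlying A) = A"
proof -
  have "(t, h) \<in> arcs G (underlying A) \<longleftrightarrow> (t, h) \<in> A" for t h
    using assms by (auto simp: arcs_def underlying_iff)
  then show ?thesis by auto
qed

text \<open>The sequences are infinite, but strict lexicographic comparison, with
  \<open>False\<close> below \<open>True\<close>, is transitive and irreflexive, hence well-founded
  on the finite set \<open>X\<close>.\<close>

lemma lex_minimal_exists:
  fixes d :: "'a \<Rightarrow> nat \<Rightarrow> bool"
  assumes "finite X" "X \<noteq> {}"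
  obtains x where "x \<in> X"
    "\<And>x' m. x' \<in> X \<Longrightarrow> (\<And>k. k < m \<Longrightarrow> d x' k = d x k) \<Longrightarrow> d x m \<Longrightarrow> d x' m"
proof -
  define less where "less x' x \<longleftrightarrow> (\<exists>m. (\<forall>k<m. d x' k = d x k) \<and> \<not> d x' m \<and> d x m)" for x' x
  define R where "R = {(x', x). x' \<in> X \<and> x \<in> X \<and> less x' x}"
  have "less x z" if xy: "less x y" and yz: "less y z" for x y z
  proof -
    obtain m where m: "\<forall>k<m. d x k = d y k" "\<not> d x m" "d y m" using xy by (auto simp: less_def)
    obtain n where n: "\<forall>k<n. d y k = d z k" "\<not> d y n" "d z n" using yz by (auto simp: less_def)
    show ?thesis
    proof (cases m n rule: linorder_cases)
      case less
      then show ?thesis unfolding less_def using m n by (intro exI[of _ m]) auto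
    next
      case equal
      then show ?thesis using m n by simp
    next
      case greater
      then show ?thesis unfolding less_def using m n by (intro exI[of _ n]) auto
    qed
  qed
  then have "trans R" unfolding R_def trans_def by blast
  moreover have "irrefl R" by (auto simp: R_def irrefl_def less_def)
  ultimately have "acyclic R" by (simp add: acyclic_irrefl)
  moreover have "R \<subseteq> X \<times> X" by (auto simp: R_def)
  then have "finite R" using assms(1) by (meson finite_SigmaI finite_subset)
  ultimately have "wf R" by (simp add: finite_acyclic_wf)
  then obtain x where x: "x \<in> X" "\<And>x'. (x', x) \<in> R \<Longrightarrow> x' \<notin> X"
    using assms(2) by (metis ex_in_conv wfE_min)
  show ?thesis
  proof (rule that[OF x(1)])
    fix x' m assume x': "x' \<in> X" "\<And>k. k < m \<Longrightarrow> d x' k = d x k" "d x m"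
    show "d x' m"
    proof (rule ccontr)
      assume "\<not> d x' m"
      then have "less x' x" unfolding less_def using x'(2,3) by (intro exI[of _ m]) simp
      then show False using x(2)[of x'] x(1) x'(1) by (simp add: R_def)
    qed
  qed
qed

text \<open>At the dart \<open>p\<close> the tree \<open>T\<close> deviates from the rule of keeping an edge that is met at its
  head and dropping an edge that is met at its tail.\<close>

definition bad :: "('v \<times> 'v) set \<Rightarrow> 'v set set \<Rightarrow> 'v \<times> 'v set \<Rightarrow> bool" where
  "bad G T p \<longleftrightarrow> (snd p \<in> T \<longleftrightarrow> (\<exists>z. (fst p, z) \<in> G \<and> snd p = {fst p, z}))"

locale ribbon_digraph =
  fixes G :: "('v::finite \<times> 'v) set" and rib :: "'v \<Rightarrow> 'v set \<Rightarrow> 'v set"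
    and b0 :: 'v and e0 :: "'v set"
  assumes antisym: "(t, h) \<in> G \<Longrightarrow> (h, t) \<notin> G"
    and ribbon: "ribbon_structure G rib"
    and basis: "is_basis G (b0, e0)"
begin

lemma simple: "simple_graph (underlying G)"
  unfolding simple_graph_def
proof
  fix e assume "e \<in> underlying G"
  then obtain t h where "(t, h) \<in> G" "e = {t, h}" by (rule underlyingE)
  then show "card e = 2" using antisym[of t h] by (cases "t = h") auto
qed

lemma spanning_tree_iff_tree:
  "spanning_tree (underlying G) T \<longleftrightarrow> T \<subseteq> underlying G \<and> tree T"
  by (rule spanning_tree_iff[OF simple])

lemma toured:
  assumes "T \<subseteq> underlying G" "tree T"
  shows "toured_tree (underlying G) rib b0 e0 T"
proof
  show "cyclic_on (rib x) (incident_edges (underlying G) x)"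
    if "incident_edges (underlying G) x \<noteq> {}" for x
    using ribbon that by (simp add: ribbon_structure_def)
  show "e0 \<in> underlying G" "b0 \<in> e0"
    using basis by (simp_all add: is_basis_def incident_edges_def)
qed (use simple assms in auto)

lemma otree_arcs:
  assumes "T \<subseteq> underlying G" "tree T"
  shows "otree (arcs G T)"
  using assms antisym by (auto simp: otree_def underlying_arcs) (auto simp: arcs_def)

lemma head_side_tail:
  assumes T: "T \<subseteq> underlying G" "tree T" and g: "(t, h) \<in> G" "{t, h} \<in> T"
    and "same_component (T - {{t, h}}) b0 t"
  shows "w \<in> head_side (arcs G T) (t, h) \<longleftrightarrow> \<not> same_component (T - {{t, h}}) b0 w"
proof -
  have "head_side (arcs G T) (t, h) = - {w. same_component (T - {{t, h}}) t w}"
    using tree_sides[OF T(2) g(2)] T by (simp add: head_side_def underlying_arcs)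
  moreover have "same_component (T - {{t, h}}) t w \<longleftrightarrow> same_component (T - {{t, h}}) b0 w"
    using assms(5) by (meson same_component_sym same_component_trans)
  ultimately show ?thesis by simp
qed

lemma head_side_head:
  assumes T: "T \<subseteq> underlying G" and "same_component (T - {{t, h}}) b0 h"
  shows "w \<in> head_side (arcs G T) (t, h) \<longleftrightarrow> same_component (T - {{t, h}}) b0 w"
proof -
  have "same_component (T - {{t, h}}) h w \<longleftrightarrow> same_component (T - {{t, h}}) b0 w"
    using assms(2) by (meson same_component_sym same_component_trans)
  then show ?thesis using T by (simp add: head_side_def underlying_arcs)
qed

text \<open>The hypotheses are asymmetric: the first difference is an edge kept by \<open>T\<close>
  and dropped by \<open>T'\<close>. The opposite case follows by exchanging the trees.\<close>

lemma jaeger_first_difference: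
  assumes y: "generic y"
    and T: "jaeger_tree G rib (b0, e0) T" "positive (arcs G T) y"
    and T': "jaeger_tree G rib (b0, e0) T'" "positive (arcs G T') y"
    and m: "m < card (darts (underlying G))"
    and agree: "\<And>k. k < m \<Longrightarrow> snd ((tour_step rib T ^^ k) (b0, e0)) \<in> T \<longleftrightarrow>
      snd ((tour_step rib T ^^ k) (b0, e0)) \<in> T'"
    and diff: "snd ((tour_step rib T ^^ m) (b0, e0)) \<in> T" "snd ((tour_step rib T ^^ m) (b0, e0)) \<notin> T'"
  shows False
proof -
  have sp: "T \<subseteq> underlying G" "tree T" "T' \<subseteq> underlying G" "tree T'"
    using T T' by (simp_all add: jaeger_tree_def spanning_tree_iff_tree)
  interpret J: toured_tree "underlying G" rib b0 e0 T by (rule toured) fact+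
  interpret J': toured_tree "underlying G" rib b0 e0 T' by (rule toured) fact+
  have same: "J'.\<tau> k = J.\<tau> k" if "k \<le> m" for k
    unfolding J.\<tau>_def J'.\<tau>_def using agree that by (rule tours_agree)
  define x e where "x = fst (J.\<tau> m)" and "e = snd (J.\<tau> m)"
  have e: "e \<in> T" "e \<notin> T'" using diff by (simp_all add: e_def J.\<tau>_def)
  have agree': "snd (J.\<tau> k) \<in> T \<longleftrightarrow> snd (J.\<tau> k) \<in> T'" if "k < m" for k
    using agree[OF that] by (simp add: J.\<tau>_def)
  have new: "snd (J.\<tau> k) \<noteq> e" if "k < m" for k
    using agree'[OF that] e by auto
  have \<tau>m: "J.\<tau> m = (x, e)" by (simp add: x_def e_def)
  have side: "same_component (T - {e}) b0 x"
    unfolding x_def using new by (rule J.first_visit)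
  obtain z where z: "e = {x, z}"
    using J.other_end_mem(1) J.tour_edge[of m] \<tau>m by (metis fst_conv snd_conv)
  \<comment> \<open>Both tours meet \<open>e\<close> first at \<open>x\<close>, and
    \<open>T'\<close> omits it; the Jaeger condition for \<open>T'\<close> makes \<open>x\<close>
    the tail.\<close>
  have "(x, z) \<in> G"
  proof (rule ccontr)
    assume "(x, z) \<notin> G"
    then have zx: "(z, x) \<in> G" using e(1) sp(1) z by (auto simp: underlying_iff)
    have "{z, x} = e" using z by (simp add: insert_commute)
    then have "current_before rib (b0, e0) T' (z, e) (x, e)"
      using T'(1) zx e(2) by (auto simp: jaeger_tree_def)
    then obtain i j where ij: "i < j" "j < J'.period" "J'.\<tau> i = (z, e)" "J'.\<tau> j = (x, e)"
      unfolding J'.current_before_iff by blast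
    have "J'.\<tau> m = (x, e)" using same[of m] \<tau>m by simp
    then have "j = m" using J'.tour_distinct[of j m] ij m J'.period_eq by simp
    then have "snd (J.\<tau> i) = e" using same[of i] ij by (metis less_imp_le_nat snd_conv)
    then show False using new ij(1) \<open>j = m\<close> by blast
  qed
  define H where "H = head_side (arcs G T) (x, z)"
  have H: "w \<in> H \<longleftrightarrow> \<not> same_component (T - {e}) b0 w" for w
    using head_side_tail[OF sp(1,2) \<open>(x, z) \<in> G\<close>] e(1) side z unfolding H_def by simp
  have "(x, z) \<in> arcs G T" using \<open>(x, z) \<in> G\<close> e(1) z by (simp add: arcs_def)
  \<comment> \<open>\<open>H\<close> is the side away from \<open>b0\<close> and has positive
    demand, so in the flow on \<open>T'\<close> some arc must enter it. That arc crosses the cut of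
    \<open>e\<close> and differs from \<open>e\<close>, so it is not in \<open>T\<close>.\<close>
  then have "(\<Sum>v\<in>H. y v) > 0" using T(2) unfolding positive_def cut_def H_def by blast
  also have "(\<Sum>v\<in>H. y v) =
    (\<Sum>g\<in>arcs G T'. cut (arcs G T') y g * (of_bool (snd g \<in> H) - of_bool (fst g \<in> H)))"
    using y by (intro flow_sum_subset flow_cut otree_arcs sp) (simp add: generic_def)
  finally obtain g where g: "g \<in> arcs G T'"
    "cut (arcs G T') y g * (of_bool (snd g \<in> H) - of_bool (fst g \<in> H)) > 0"
    by (meson linorder_not_less sum_nonpos)
  obtain a b where ab: "g = (a, b)" by (cases g)
  have "cut (arcs G T') y g > 0" using g(1) T'(2) by (simp add: positive_def)
  then have "b \<in> H" "a \<notin> H" using g(2) ab by (auto simp: zero_less_mult_iff of_bool_def split: if_splits)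
  then have bH: "\<not> same_component (T - {e}) b0 b" and aH: "same_component (T - {e}) b0 a"
    using H by auto
  have G: "(a, b) \<in> G" "{a, b} \<in> T'" using g(1) ab by (simp_all add: arcs_def)
  have "{a, b} \<notin> T"
  proof
    assume "{a, b} \<in> T"
    moreover have "{a, b} \<noteq> e" using G(2) e(2) by blast
    ultimately show False using J.component_edge[of a b e b0] aH bH by simp
  qed
  then have "current_before rib (b0, e0) T (a, {a, b}) (b, {a, b})"
    using T(1) G(1) by (auto simp: jaeger_tree_def)
  then obtain i j where ij: "i < j" "j < J.period" "J.\<tau> i = (a, {a, b})" "J.\<tau> j = (b, {a, b})"
    unfolding J.current_before_iff by blast
  \<comment> \<open>No time is left for meeting the arc at its tail \<open>a\<close>: before
    \<open>m\<close> the trees agree on the current edges, and after \<open>m\<close> a visit to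
    \<open>a\<close> means that the tour is back on the side of \<open>b0\<close> for good and
    misses the head \<open>b\<close>.\<close>
  consider "i < m" | "i = m" | "m < i" by linarith
  then show False
  proof cases
    case 1
    then show False using agree'[of i] ij(3) \<open>{a, b} \<notin> T\<close> G(2) by simp
  next
    case 2
    then show False using \<tau>m ij(3) \<open>{a, b} \<notin> T\<close> e(1) by simp
  next
    case 3
    have "same_component (T - {e}) b0 (fst (J.\<tau> j))"
      using J.no_second_crossing[of e m i j] 3 ij e(1) \<tau>m side aH by simp
    then show False using ij(4) bH by simp
  qed
qed

theorem jaeger_unique:
  assumes y: "generic y"
    and T: "jaeger_tree G rib (b0, e0) T" "positive (arcs G T) y"
    and T': "jaeger_tree G rib (b0, e0) T'" "positive (arcs G T') y"
  shows "T = T'"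
proof (rule ccontr)
  assume "T \<noteq> T'"
  have sp: "T \<subseteq> underlying G" "tree T" "T' \<subseteq> underlying G"
    using T T' by (simp_all add: jaeger_tree_def spanning_tree_iff_tree)
  let ?\<tau> = "\<lambda>T k. (tour_step rib T ^^ k) (b0, e0)"
  let ?P = "\<lambda>k. k < card (darts (underlying G)) \<and> (snd (?\<tau> T k) \<in> T \<longleftrightarrow> snd (?\<tau> T k) \<notin> T')"
  have "\<exists>k. ?P k"
    using tours_agree_all[OF toured[OF sp(1,2)] sp(3)] \<open>T \<noteq> T'\<close> by blast
  then have "?P (LEAST k. ?P k)" by (rule LeastI_ex)
  then obtain m where m: "m = (LEAST k. ?P k)" "?P m" by blast
  have agree: "snd (?\<tau> T k) \<in> T \<longleftrightarrow> snd (?\<tau> T k) \<in> T'" if "k < m" for k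
    using not_less_Least[of k ?P] that m by auto
  have same: "?\<tau> T' k = ?\<tau> T k" if "k \<le> m" for k
    using agree that by (rule tours_agree)
  have agree': "snd (?\<tau> T' k) \<in> T' \<longleftrightarrow> snd (?\<tau> T' k) \<in> T" if "k < m" for k
    using agree[OF that] same[of k] that by simp
  show False
  proof (cases "snd (?\<tau> T m) \<in> T")
    case True
    then show False using jaeger_first_difference[OF y T T' _ agree, of m] m(2) by blast
  next
    case False
    then show False
      using jaeger_first_difference[OF y T' T _ agree', of m] m(2) same[of m] by simp
  qed
qed

text \<open>Among the trees whose cone contains \<open>y\<close>, one whose sequence of deviations along its tour is
  lexicographically minimal is a Jaeger tree: pivoting in an arc that violates the Jaeger condition
  would improve the sequence. The potential \<open>l\<close> provides an arc that can leave.\<close>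

theorem jaeger_exists:
  assumes y: "generic y" and l: "\<And>t h. (t, h) \<in> G \<Longrightarrow> l h - l t = (1 :: int)"
    and A: "otree A" "positive A y" "A \<subseteq> G"
  obtains T where "jaeger_tree G rib (b0, e0) T" "positive (arcs G T) y"
proof -
  define X where "X = {T. T \<subseteq> underlying G \<and> tree T \<and> positive (arcs G T) y}"
  have inX: "underlying A \<in> X" if "otree A" "positive A y" "A \<subseteq> G" for A
  proof -
    have "arcs G (underlying A) = A" using antisym that(3) by (rule arcs_underlying)
    moreover have "underlying A \<subseteq> underlying G" using that(3) by (auto simp: underlying_image)
    ultimately show ?thesis using that by (simp add: X_def otree_def)
  qed
  have "X \<noteq> {}" using inX[OF A] by blast
  then obtain T where "T \<in> X" and min: "\<And>T' m. T' \<in> X \<Longrightarrow>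
    (\<And>k. k < m \<Longrightarrow> bad G T' ((tour_step rib T' ^^ k) (b0, e0)) = bad G T ((tour_step rib T ^^ k) (b0, e0))) \<Longrightarrow>
    bad G T ((tour_step rib T ^^ m) (b0, e0)) \<Longrightarrow> bad G T' ((tour_step rib T' ^^ m) (b0, e0))"
    using lex_minimal_exists[of X "\<lambda>T k. bad G T ((tour_step rib T ^^ k) (b0, e0))"] by auto
  then have T: "T \<subseteq> underlying G" "tree T" "positive (arcs G T) y" by (simp_all add: X_def)
  interpret J: toured_tree "underlying G" rib b0 e0 T by (rule toured) fact+
  have "current_before rib (b0, e0) T (z, {z, x}) (x, {z, x})" if zx: "(z, x) \<in> G" "{z, x} \<notin> T" for z x
  proof (rule ccontr)
    define e where "e = {z, x}"
    assume not: "\<not> current_before rib (b0, e0) T (z, {z, x}) (x, {z, x})"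
    have "z \<noteq> x" using antisym zx(1) by blast
    have "e \<in> underlying G" using zx(1) by (simp add: e_def underlying_iff)
    then have "(x, e) \<in> darts (underlying G)" "(z, e) \<in> darts (underlying G)"
      by (simp_all add: darts_def e_def)
    then obtain i j where i: "i < J.period" "J.\<tau> i = (x, e)" and j: "j < J.period" "J.\<tau> j = (z, e)"
      using J.tour_covers by metis
    have "i \<noteq> j" using i j \<open>z \<noteq> x\<close> by auto
    moreover have "\<not> j < i" using not i j unfolding J.current_before_iff e_def by blast
    ultimately have "i < j" by simp
    define B where "B = arcs G T"
    have B: "otree B" "underlying B = T" "B \<subseteq> G"
      using T otree_arcs by (auto simp: B_def underlying_arcs) (auto simp: arcs_def)
    have lB: "l (snd g) - l (fst g) = 1" if "g \<in> B" for g
      using that B(3) l[of "fst g" "snd g"] by auto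
    have lt: "l z < l x" using l[OF zx(1)] by simp
    have posB: "positive B y" using T(3) by (simp add: B_def)
    have newB: "{z, x} \<notin> underlying B" using zx(2) B(2) by simp
    from pivot[OF y B(1) posB newB lB lt]
    obtain f where f: "f \<in> B" "z \<notin> head_side B f" "x \<in> head_side B f"
      and B': "otree (insert (z, x) (B - {f}))" "positive (insert (z, x) (B - {f})) y"
      by metis
    define fe where "fe = {fst f, snd f}"
    define T' where "T' = insert e (T - {fe})"
    have "underlying (insert (z, x) (B - {f})) = T'"
      using underlying_exchange[OF B(1) f(1)] B(2) by (simp add: T'_def fe_def e_def)
    then have T': "T' \<in> X" using inX[OF B'] B(3) zx(1) by auto
    have fT: "fe \<in> T" "f \<in> G" using f(1) by (simp_all add: fe_def B_def arcs_def)
    have "e \<noteq> fe" using zx(2) fT(1) by (auto simp: e_def)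
    have ex: "snd (J.\<tau> i) \<in> {e, fe}" using i by simp
    \<comment> \<open>Before \<open>m\<close> no exchanged edge is current, so the tours of
      \<open>T\<close> and \<open>T'\<close> coincide up to \<open>m\<close> and the comparison is
      decided there.\<close>
    define m where "m = (LEAST k. snd (J.\<tau> k) \<in> {e, fe})"
    have m: "snd (J.\<tau> m) \<in> {e, fe}" unfolding m_def using ex by (rule LeastI)
    have "m \<le> i" unfolding m_def using ex by (rule Least_le)
    have before: "snd (J.\<tau> k) \<notin> {e, fe}" if "k < m" for k
      using not_less_Least[OF that[unfolded m_def]] .
    have agree: "snd ((tour_step rib T ^^ k) (b0, e0)) \<in> T \<longleftrightarrow> snd ((tour_step rib T ^^ k) (b0, e0)) \<in> T'"
      if "k < m" for k
      using before[OF that] by (auto simp: J.\<tau>_def T'_def)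
    have same: "(tour_step rib T' ^^ k) (b0, e0) = J.\<tau> k" if "k \<le> m" for k
      unfolding J.\<tau>_def using agree that by (rule tours_agree)
    have "bad G T (J.\<tau> m) \<and> \<not> bad G T' (J.\<tau> m)"
    proof (cases "snd (J.\<tau> m) = e")
      case True
      have "fst (J.\<tau> m) = x \<or> fst (J.\<tau> m) = z" using J.tour_edge(2)[of m] True by (auto simp: e_def)
      \<comment> \<open>The edge is met at its tail only at time \<open>j\<close>, and
        \<open>m \<le> i < j\<close>.\<close>
      moreover have "fst (J.\<tau> m) \<noteq> z"
      proof
        assume "fst (J.\<tau> m) = z"
        then have "J.\<tau> m = J.\<tau> j" using True j by (simp add: prod_eq_iff)
        then show False using J.tour_distinct[of m j] j \<open>m \<le> i\<close> \<open>i < j\<close> by simp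
      qed
      ultimately have "J.\<tau> m = (x, e)" using True by (simp add: prod_eq_iff)
      moreover have "\<not> (\<exists>z'. (x, z') \<in> G \<and> e = {x, z'})"
        using antisym[OF zx(1)] by (auto simp: e_def doubleton_eq_iff)
      moreover have "e \<notin> T" using zx(2) by (simp add: e_def)
      ultimately show ?thesis by (simp add: bad_def T'_def)
    next
      case False
      then have mf: "snd (J.\<tau> m) = fe" using m by simp
      then have "m \<noteq> i" using i \<open>e \<noteq> fe\<close> by auto
      then have "m < i" using \<open>m \<le> i\<close> by simp
      define p where "p = fst (J.\<tau> m)"
      have side: "same_component (T - {fe}) b0 p"
        unfolding p_def by (rule J.first_visit) (use before in auto)
      have "p = fst f \<or> p = snd f" using J.tour_edge(2)[of m] mf by (auto simp: fe_def p_def)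
      \<comment> \<open>If \<open>f\<close> were met first at its head, its head side would be the
        side of \<open>b0\<close>. The visit to \<open>x\<close> at time \<open>i\<close> shows that
        the tour is there after \<open>m\<close>, so it could not reach \<open>z\<close> on the
        other side at time \<open>j\<close>.\<close>
      moreover have "p \<noteq> snd f"
      proof
        assume "p = snd f"
        then have H: "w \<in> head_side B f \<longleftrightarrow> same_component (T - {fe}) b0 w" for w
          using head_side_head[OF T(1), of "fst f" "snd f" w] side by (simp add: B_def fe_def)
        have "same_component (T - {fe}) b0 (fst (J.\<tau> j))"
          using J.no_second_crossing[OF fT(1) mf _ \<open>m < i\<close> _ j(1)] side f(3) H i \<open>i < j\<close>
          by (simp add: p_def)
        then show False using j H f(2) by simp
      qed
      ultimately have "J.\<tau> m = (fst f, fe)" using mf by (simp add: prod_eq_iff p_def)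
      moreover have "\<exists>z. (fst f, z) \<in> G \<and> fe = {fst f, z}"
        using fT(2) by (intro exI[of _ "snd f"]) (simp add: fe_def)
      ultimately show ?thesis
        using fT(1) \<open>e \<noteq> fe\<close> by (simp add: bad_def T'_def)
    qed
    moreover have "bad G T' ((tour_step rib T' ^^ k) (b0, e0)) = bad G T ((tour_step rib T ^^ k) (b0, e0))"
      if "k < m" for k
      using same[of k] agree[of k] that by (simp add: bad_def J.\<tau>_def)
    ultimately show False
      using min[OF T', of m] same[of m] by (simp add: J.\<tau>_def)
  qed
  then have "jaeger_tree G rib (b0, e0) T"
    using T by (auto simp: jaeger_tree_def spanning_tree_iff_tree)
  then show ?thesis using that T(3) by blast
qed

end

section \<open>Dimensions\<close>

definition arc_vec :: "'v \<times> 'v \<Rightarrow> real ^ 'v::finite" where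
  "arc_vec g = axis (snd g) 1 - axis (fst g) 1"

lemma inner_arc_vec: "a \<bullet> arc_vec g = a $ snd g - a $ fst g"
  by (simp add: arc_vec_def inner_diff_right inner_axis)

text \<open>Differences of arbitrary basis vectors are reached along paths, and a vector with
  coordinate sum 0 is a combination of differences with one fixed basis vector, here that of
  \<open>undefined\<close>.\<close>

lemma span_edge_vectors:
  fixes F :: "'v::finite set set"
  assumes "connected_graph F"
  shows "span {axis u 1 - axis v 1 | u v. {u, v} \<in> F} = {x :: real ^ 'v. 1 \<bullet> x = 0}"
    (is "span ?W = ?H")
proof
  show "span ?W \<subseteq> ?H"
    by (rule span_minimal) (auto simp: inner_diff_right inner_axis subspace_hyperplane)
  show "?H \<subseteq> span ?W"
  proof
    fix x :: "real ^ 'v" assume "x \<in> ?H"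
    then have x: "(\<Sum>v\<in>UNIV. x $ v) = 0" by (simp add: inner_vec_def)
    have diff: "axis v 1 - axis u 1 \<in> span ?W" for u v :: 'v
    proof -
      have "same_component F u v" using assms by (simp add: connected_graph_def)
      then have "(axis u 1 - axis u 1 \<in> span ?W) = (axis v 1 - axis u 1 \<in> span ?W)"
      proof (rule same_component_const)
        fix a b assume ab: "{a, b} \<in> F"
        have "{b, a} \<in> F" using ab by (simp add: insert_commute)
        then have "axis b 1 - axis a 1 \<in> span ?W" "axis a 1 - axis b 1 \<in> span ?W"
          using ab by (blast intro: span_base)+
        moreover have "axis b 1 - axis u 1 = (axis b 1 - axis a 1) + (axis a 1 - axis u (1::real))"
          "axis a 1 - axis u 1 = (axis a 1 - axis b 1) + (axis b 1 - axis u (1::real))" by simp_all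
        ultimately show "(axis a 1 - axis u 1 \<in> span ?W) = (axis b 1 - axis u 1 \<in> span ?W)"
          by (metis (no_types, lifting) span_add)
      qed
      then show ?thesis by (simp add: span_zero)
    qed
    have "x = (\<Sum>v\<in>UNIV. x $ v *\<^sub>R axis v 1)"
      using basis_expansion[of x] by (simp add: scalar_mult_eq_scaleR)
    also have "\<dots> = (\<Sum>v\<in>UNIV. x $ v *\<^sub>R (axis v 1 - axis undefined 1))"
      using x by (simp add: scaleR_diff_right sum_subtractf flip: scaleR_sum_left)
    also have "\<dots> \<in> span ?W"
      by (intro span_sum span_scale diff)
    finally show "x \<in> span ?W" .
  qed
qed

lemma dim_edge_vectors:
  fixes F :: "'v::finite set set"
  assumes "connected_graph F"
  shows "dim {axis u 1 - axis v 1 :: real ^ 'v | u v. {u, v} \<in> F} = CARD('v) - 1"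
proof -
  have "dim (span {axis u 1 - axis v 1 :: real ^ 'v | u v. {u, v} \<in> F}) = CARD('v) - 1"
    unfolding span_edge_vectors[OF assms] by (subst dim_hyperplane) auto
  then show ?thesis by (simp only: dim_span)
qed

text \<open>Linear algebra replaces a leaf induction: the arc vectors are independent, being dual to
  the indicators of head sides, and they span the hyperplane of coordinate sum 0.\<close>

lemma card_otree:
  fixes A :: "('v::finite \<times> 'v) set"
  assumes A: "otree A"
  shows "card A = CARD('v) - 1"
proof -
  define ind :: "'v \<times> 'v \<Rightarrow> real ^ 'v" where "ind g = (\<chi> v. of_bool (v \<in> head_side A g))" for g
  have ind: "ind g \<bullet> arc_vec g' = of_bool (g' = g)" if "g \<in> A" "g' \<in> A" for g g'
    using head_side_arc[OF A, of g g'] fst_notin_head_side[OF A, of g] snd_in_head_side[of g A] that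
    by (auto simp: inner_arc_vec ind_def)
  have inj: "inj_on arc_vec A"
  proof (rule inj_onI)
    fix g g' assume g: "g \<in> A" "g' \<in> A" "(arc_vec g :: real ^ 'v) = arc_vec g'"
    have "ind g \<bullet> arc_vec g = ind g \<bullet> arc_vec g'" by (rule arg_cong[OF g(3)])
    then have "(of_bool (g' = g) :: real) = 1" unfolding ind[OF g(1,1)] ind[OF g(1,2)] by simp
    then show "g = g'" by simp
  qed
  have "independent (arc_vec ` A)"
  proof (rule independent_if_scalars_zero)
    fix f :: "real ^ 'v \<Rightarrow> real" and x :: "real ^ 'v"
    assume 0: "(\<Sum>x\<in>arc_vec ` A. f x *\<^sub>R x) = 0" and "x \<in> arc_vec ` A"
    then obtain g where g: "g \<in> A" "x = arc_vec g" by blast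
    have "0 = ind g \<bullet> (\<Sum>g'\<in>A. f (arc_vec g') *\<^sub>R arc_vec g')"
      using 0 by (simp add: sum.reindex[OF inj])
    also have "\<dots> = (\<Sum>g'\<in>A. f (arc_vec g') * of_bool (g' = g))"
      using g by (simp add: inner_sum_right ind)
    also have "\<dots> = f x"
      using g by (simp add: of_bool_def if_distrib[of "\<lambda>x. _ * x"] cong: if_cong)
    finally show "f x = 0" by simp
  qed simp
  moreover have "span (arc_vec ` A) = span {axis u 1 - axis v 1 :: real ^ 'v | u v. {u, v} \<in> underlying A}"
  proof (rule span_eq[THEN iffD2], intro conjI subsetI)
    fix w :: "real ^ 'v" assume "w \<in> arc_vec ` A"
    then obtain g where "g \<in> A" "w = arc_vec g" by blast
    then have "{snd g, fst g} \<in> underlying A" "w = axis (snd g) 1 - axis (fst g) 1"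
      by (simp_all add: underlying_iff arc_vec_def)
    then show "w \<in> span {axis u 1 - axis v 1 | u v. {u, v} \<in> underlying A}"
      by (blast intro: span_base)
  next
    fix w :: "real ^ 'v" assume "w \<in> {axis u 1 - axis v 1 | u v. {u, v} \<in> underlying A}"
    then obtain u v where "w = axis u 1 - axis v 1" "(u, v) \<in> A \<or> (v, u) \<in> A"
      by (auto simp: underlying_iff)
    then have "w \<in> arc_vec ` A \<or> - w \<in> arc_vec ` A"
      by (force simp: arc_vec_def image_iff)
    then show "w \<in> span (arc_vec ` A)"
      using span_base[of w "arc_vec ` A"] span_neg[OF span_base[of "- w" "arc_vec ` A"]]
      by (metis minus_minus)
  qed
  then have "dim (arc_vec ` A :: (real ^ 'v) set) = CARD('v) - 1"
    unfolding dim_edge_vectors[OF otree_connected[OF A], symmetric] by (rule span_eq_dim)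
  ultimately have "card (arc_vec ` A :: (real ^ 'v) set) = CARD('v) - 1"
    by (simp add: dim_eq_card_independent)
  then show ?thesis using card_image[OF inj] by simp
qed

lemma zero_in_symmetric_edge_polytope:
  fixes E :: "'v::finite set set"
  assumes "simple_graph E" "E \<noteq> {}"
  shows "0 \<in> symmetric_edge_polytope E"
proof -
  obtain e where "e \<in> E" using assms(2) by blast
  then obtain u v where "{u, v} \<in> E" using assms(1) by (metis card_2_iff simple_graph_def)
  then have "{u, v} \<in> E" "{v, u} \<in> E" by (simp_all add: insert_commute)
  then have "axis u 1 - axis v 1 \<in> symmetric_edge_polytope E"
    "axis v 1 - axis u 1 \<in> symmetric_edge_polytope E"
    unfolding symmetric_edge_polytope_def by (blast intro: hull_inc)+
  then have "(1/2) *\<^sub>R (axis u 1 - axis v 1) + (1/2) *\<^sub>R (axis v 1 - axis u 1) \<in> symmetric_edge_polytope E"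
    unfolding symmetric_edge_polytope_def by (intro convexD convex_convex_hull) auto
  then show ?thesis by (simp flip: scaleR_add_right)
qed

lemma aff_dim_symmetric_edge_polytope:
  fixes E :: "'v::finite set set"
  assumes "simple_graph E" "connected_graph E" "E \<noteq> {}"
  shows "aff_dim (symmetric_edge_polytope E) = int (CARD('v) - 1)"
proof -
  let ?W = "{axis u 1 - axis v 1 :: real ^ 'v | u v. {u, v} \<in> E}"
  have "0 \<in> affine hull ?W"
    using zero_in_symmetric_edge_polytope[OF assms(1,3)] convex_hull_subset_affine_hull
    unfolding symmetric_edge_polytope_def by blast
  then have "aff_dim ?W = int (dim ?W)" by (rule aff_dim_zero)
  then show ?thesis
    by (simp add: symmetric_edge_polytope_def aff_dim_convex_hull dim_edge_vectors[OF assms(2)])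
qed

section \<open>Counting coefficient vectors\<close>

text \<open>Lattice points of the \<open>k\<close>-th dilate of a unimodular simplex with apex 0 and
  further vertices \<open>A\<close>, without the facets opposite \<open>B\<close>. The slack in the
  last inequality is the weight of the apex.\<close>

definition comps :: "'a set \<Rightarrow> 'a set \<Rightarrow> nat \<Rightarrow> ('a \<Rightarrow> nat) set" where
  "comps A B k = {c. (\<forall>x. x \<notin> A \<longrightarrow> c x = 0) \<and> (\<forall>x\<in>B. 0 < c x) \<and> (\<Sum>x\<in>A. c x) \<le> k}"

lemma finite_comps:
  assumes "finite A"
  shows "finite (comps A B k)"
proof (rule finite_subset)
  show "comps A B k \<subseteq> {c. \<forall>x. (x \<in> A \<longrightarrow> c x \<in> {..k}) \<and> (x \<notin> A \<longrightarrow> c x = 0)}"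
  proof (intro subsetI CollectI allI conjI impI)
    fix c x assume c: "c \<in> comps A B k"
    show "c x = 0" if "x \<notin> A" using c that by (simp add: comps_def)
    show "c x \<in> {..k}" if "x \<in> A"
      using member_le_sum[of x A c] that assms c by (simp add: comps_def)
  qed
  show "finite {c. \<forall>x. (x \<in> A \<longrightarrow> c x \<in> {..k}) \<and> (x \<notin> A \<longrightarrow> c x = 0)}"
    using assms by (intro finite_set_of_finite_funs) auto
qed

text \<open>Lowering each coordinate in \<open>B\<close> by 1 restores the removed facets and uses
  up \<open>card B\<close> of the bound. This is the origin of the power of t in the series.\<close>

lemma card_comps_shift:
  assumes "finite A" "B \<subseteq> A"
  shows "card (comps A B k) = (if k < card B then 0 else card (comps A {} (k - card B)))"
proof -
  have B: "(\<Sum>x\<in>A. of_bool (x \<in> B)) = card B"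
    using assms by (simp add: of_bool_def sum.If_cases Int_absorb1)
  have le: "card B \<le> (\<Sum>x\<in>A. c x)" "(\<Sum>x\<in>A. c x - of_bool (x \<in> B)) = (\<Sum>x\<in>A. c x) - card B"
    if "\<forall>x\<in>B. 0 < c x" for c :: "'a \<Rightarrow> nat"
  proof -
    have c: "of_bool (x \<in> B) \<le> c x" for x using that by (auto simp: Suc_le_eq)
    show "card B \<le> (\<Sum>x\<in>A. c x)" unfolding B[symmetric] by (intro sum_mono c)
    show "(\<Sum>x\<in>A. c x - of_bool (x \<in> B)) = (\<Sum>x\<in>A. c x) - card B"
      unfolding B[symmetric] by (rule sum_subtractf_nat) (rule c)
  qed
  show ?thesis
  proof (cases "k < card B")
    case True
    then have "comps A B k = {}" using le(1) by (fastforce simp: comps_def)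
    then show ?thesis using True by simp
  next
    case False
    have "bij_betw (\<lambda>c x. c x - of_bool (x \<in> B)) (comps A B k) (comps A {} (k - card B))"
    proof (rule bij_betw_byWitness[where f' = "\<lambda>c x. c x + of_bool (x \<in> B)"])
      show "\<forall>c\<in>comps A B k. (\<lambda>x. c x - of_bool (x \<in> B) + of_bool (x \<in> B)) = c"
        by (fastforce simp: comps_def)
      show "\<forall>c\<in>comps A {} (k - card B). (\<lambda>x. c x + of_bool (x \<in> B) - of_bool (x \<in> B)) = c"
        by simp
      show "(\<lambda>c x. c x - of_bool (x \<in> B)) ` comps A B k \<subseteq> comps A {} (k - card B)"
        using le(2) by (auto simp: comps_def)
      show "(\<lambda>c x. c x + of_bool (x \<in> B)) ` comps A {} (k - card B) \<subseteq> comps A B k"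
        using False assms(2) B by (auto simp: comps_def sum.distrib)
    qed
    then show ?thesis using False by (simp add: bij_betw_same_card)
  qed
qed

text \<open>Either \<open>c a\<close> is 0 or it can be lowered by 1. For the generating functions
  this means one more factor 1 / (1 - t).\<close>

lemma card_comps_insert:
  assumes "finite A" "a \<notin> A"
  shows "card (comps (insert a A) {} k) =
    card (comps A {} k) + (if k = 0 then 0 else card (comps (insert a A) {} (k - 1)))"
proof -
  have "comps (insert a A) {} k = comps A {} k \<union> comps (insert a A) {a} k"
    using assms by (auto simp: comps_def) (metis neq0_conv)
  moreover have "comps A {} k \<inter> comps (insert a A) {a} k = {}"
    using assms(2) by (auto simp: comps_def)
  ultimately have "card (comps (insert a A) {} k) = card (comps A {} k) + card (comps (insert a A) {a} k)"
    using assms(1) by (simp add: card_Un_disjoint finite_comps)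
  then show ?thesis using card_comps_shift[of "insert a A" "{a}" k] assms(1) by auto
qed

lemma fps_comps_empty:
  fixes A :: "'a set"
  assumes "finite A"
  shows "Abs_fps (\<lambda>k. real (card (comps A {} k))) * (1 - fps_X) ^ Suc (card A) = 1"
  using assms
proof induction
  case empty
  have "comps {} {} k = {\<lambda>_ :: 'a. 0}" for k by (auto simp: comps_def)
  then show ?case by (intro fps_ext) (simp add: right_diff_distrib)
next
  case (insert a A)
  let ?G = "\<lambda>A. Abs_fps (\<lambda>k. real (card (comps A {} k)))"
  have "?G (insert a A) * (1 - fps_X) = ?G A"
  proof (rule fps_ext)
    fix k
    show "fps_nth (?G (insert a A) * (1 - fps_X)) k = fps_nth (?G A) k"
      using card_comps_insert[OF insert.hyps, of k] by (cases k) (simp_all add: right_diff_distrib)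
  qed
  then have "?G A * (1 - fps_X) ^ Suc (card A) = ?G (insert a A) * (1 - fps_X) * (1 - fps_X) ^ Suc (card A)"
    by (simp only:)
  also have "\<dots> = ?G (insert a A) * (1 - fps_X) ^ Suc (card (insert a A))"
    by (simp only: card_insert_disjoint[OF insert.hyps] power_Suc mult.assoc)
  finally have eq: "?G A * (1 - fps_X) ^ Suc (card A) =
    ?G (insert a A) * (1 - fps_X) ^ Suc (card (insert a A))" .
  show ?case by (rule trans[OF eq[symmetric] insert.IH])
qed

lemma fps_comps:
  assumes "finite A" "B \<subseteq> A"
  shows "Abs_fps (\<lambda>k. real (card (comps A B k))) * (1 - fps_X) ^ Suc (card A) = fps_X ^ card B"
proof -
  have "Abs_fps (\<lambda>k. real (card (comps A B k))) =
    fps_X ^ card B * Abs_fps (\<lambda>k. real (card (comps A {} k)))"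
    by (intro fps_ext) (simp add: card_comps_shift[OF assms] fps_X_power_mult_nth)
  then show ?thesis using fps_comps_empty[OF assms(1)] by (simp add: mult.assoc)
qed

section \<open>The half-open decomposition\<close>

text \<open>\<open>x\<close> is moved slightly in the direction \<open>\<Sum>\<^sub>v (b0 - v)\<close> and scaled by \<open>CARD('v)\<close> to stay integral.
  The result lies on no wall, and it lies in the cone of a tree iff \<open>x\<close> lies in that cone but not on
  a facet opposite a tail-edge.\<close>

definition perturb :: "'v \<Rightarrow> ('v::finite \<Rightarrow> int) \<Rightarrow> 'v \<Rightarrow> int" where
  "perturb b0 x v = int CARD('v) * x v - 1 + (if v = b0 then int CARD('v) else 0)"

lemma sum_perturb:
  fixes x :: "'v::finite \<Rightarrow> int"
  shows "(\<Sum>v\<in>S. perturb b0 x v) =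
    int CARD('v) * (\<Sum>v\<in>S. x v) - int (card S) + (if b0 \<in> S then int CARD('v) else 0)"
  by (simp add: perturb_def sum.distrib sum_subtractf sum_distrib_left)

lemma card_proper:
  fixes S :: "'v::finite set"
  assumes "S \<noteq> {}" "S \<noteq> UNIV"
  shows "0 < int (card S)" "int (card S) < int CARD('v)"
  using assms psubset_card_mono[of UNIV S] by (auto simp: card_gt_0_iff)

text \<open>The point of scaling by \<open>CARD('v)\<close>: the perturbation of a proper subset
  amounts to less than one multiple of it, so the comparison with \<open>n * q\<close> reads off the
  sign of \<open>q\<close>.\<close>

lemma less_mult_iff:
  fixes n k q :: int
  assumes "0 < k" "k < n"
  shows "k < n * q \<longleftrightarrow> 0 < q" "k \<noteq> n * q"
proof -
  have "if 0 < q then k < n * q else n * q < k"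
  proof (cases "0 < q")
    case True
    then have "n * 1 \<le> n * q" using assms by (intro mult_left_mono) auto
    then have "k < n * q" using assms(2) by linarith
    then show ?thesis using True by simp
  next
    case False
    then have "n * q \<le> 0" using assms by (simp add: mult_nonneg_nonpos)
    then show ?thesis using False assms by simp
  qed
  then show "k < n * q \<longleftrightarrow> 0 < q" "k \<noteq> n * q"
    by (auto split: if_splits)
qed

text \<open>The total over a proper \<open>S\<close> is a multiple of \<open>CARD('v)\<close> minus
  \<open>card S\<close>, and \<open>card S\<close> is no such multiple.\<close>

lemma generic_perturb:
  fixes x :: "'v::finite \<Rightarrow> int"
  assumes "(\<Sum>v\<in>UNIV. x v) = 0"
  shows "generic (perturb b0 x)"
  unfolding generic_def
proof (intro conjI allI impI notI)
  show "(\<Sum>v\<in>UNIV. perturb b0 x v) = 0" using assms by (simp add: sum_perturb)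
  fix S :: "'v set" assume S: "S \<noteq> {}" "S \<noteq> UNIV" and 0: "(\<Sum>v\<in>S. perturb b0 x v) = 0"
  have "int (card S) = int CARD('v) * ((\<Sum>v\<in>S. x v) + of_bool (b0 \<in> S))"
    using 0 by (simp add: sum_perturb distrib_left split: if_splits)
  then show False using less_mult_iff(2)[OF card_proper[OF S]] by blast
qed

text \<open>A head side that contains \<open>b0\<close> gains from the perturbation, so
  \<open>cut A x g\<close> may vanish; otherwise it loses, and the cut must be positive
  beforehand.\<close>

lemma cut_perturb:
  fixes A :: "('v::finite \<times> 'v) set"
  assumes "otree A" "g \<in> A"
  shows "0 < cut A (perturb b0 x) g \<longleftrightarrow>
    (if b0 \<in> head_side A g then 0 \<le> cut A x g else 0 < cut A x g)"
proof -
  let ?H = "head_side A g"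
  have H: "?H \<noteq> {}" "?H \<noteq> UNIV"
    using fst_notin_head_side[OF assms] snd_in_head_side[of g A] by auto
  have "0 < cut A (perturb b0 x) g \<longleftrightarrow>
    int (card ?H) < int CARD('v) * (cut A x g + of_bool (b0 \<in> ?H))"
    unfolding cut_def by (auto simp: sum_perturb distrib_left)
  then show ?thesis
    unfolding less_mult_iff(1)[OF card_proper[OF H]] by auto
qed

lemma tail_edges_eq:
  assumes "T \<subseteq> underlying G" "tree T"
  shows "tail_edges G b0 T = {g \<in> arcs G T. b0 \<notin> head_side (arcs G T) g}"
proof -
  have "same_component (T - {{t, h}}) t b0 \<longleftrightarrow> b0 \<notin> head_side (arcs G T) (t, h)"
    if "{t, h} \<in> T" for t h
  proof -
    have "head_side (arcs G T) (t, h) = - {w. same_component (T - {{t, h}}) t w}"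
      using tree_sides[OF assms(2) that] assms(1) by (simp add: head_side_def underlying_arcs)
    then show ?thesis by simp
  qed
  then show ?thesis by (auto simp: tail_edges_def arcs_def)
qed

section \<open>Lattice points as flows with natural coefficients\<close>

definition emb :: "('v::finite \<times> 'v) set \<Rightarrow> ('v \<times> 'v \<Rightarrow> nat) \<Rightarrow> real ^ 'v" where
  "emb A c = (\<Sum>g\<in>A. real (c g) *\<^sub>R arc_vec g)"

lemma inner_emb: "a \<bullet> emb A c = (\<Sum>g\<in>A. real (c g) * (a $ snd g - a $ fst g))"
  by (simp add: emb_def inner_sum_right inner_arc_vec)

lemma emb_nth:
  "emb A c $ u = real_of_int (\<Sum>g\<in>A. int (c g) * (of_bool (snd g \<in> {u}) - of_bool (fst g \<in> {u})))"
proof -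
  have "emb A c $ u = axis u 1 \<bullet> emb A c" by (simp add: inner_axis')
  then show ?thesis by (auto simp: inner_emb axis_def intro!: sum.cong)
qed

lemma flow_iff_emb:
  "flow A (\<lambda>g. int (c g)) x \<longleftrightarrow> emb A c = (\<chi> v. real_of_int (x v))"
proof
  assume fl: "flow A (\<lambda>g. int (c g)) x"
  show "emb A c = (\<chi> v. real_of_int (x v))"
  proof (subst vec_eq_iff, rule allI)
    fix u
    show "emb A c $ u = (\<chi> v. real_of_int (x v)) $ u"
      unfolding emb_nth using flow_sum_subset[OF fl, of "{u}"] by simp
  qed
next
  assume eq: "emb A c = (\<chi> v. real_of_int (x v))"
  show "flow A (\<lambda>g. int (c g)) x"
    unfolding flow_def
  proof
    fix \<phi> :: "'a \<Rightarrow> int"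
    define a :: "real ^ 'a" where "a = (\<chi> v. real_of_int (\<phi> v))"
    have "real_of_int (\<Sum>v\<in>UNIV. \<phi> v * x v) = a \<bullet> emb A c"
      unfolding eq by (simp add: inner_vec_def a_def)
    also have "\<dots> = real_of_int (\<Sum>g\<in>A. int (c g) * (\<phi> (snd g) - \<phi> (fst g)))"
      by (simp add: inner_emb a_def)
    finally show "(\<Sum>v\<in>UNIV. \<phi> v * x v) = (\<Sum>g\<in>A. int (c g) * (\<phi> (snd g) - \<phi> (fst g)))"
      by (simp only: of_int_eq_iff)
  qed
qed

section \<open>The cells of all facet graphs together\<close>

locale ribbon_family =
  fixes E :: "'v::finite set set" and b0 :: 'v
    and rib :: "('v \<times> 'v) set \<Rightarrow> 'v \<Rightarrow> 'v set \<Rightarrow> 'v set"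
    and base_edge :: "('v \<times> 'v) set \<Rightarrow> 'v set"
  assumes E: "simple_graph E" "connected_graph E"
    and rib: "\<And>G. G \<in> facet_graphs E \<Longrightarrow> ribbon_structure G (rib G)"
    and basis: "\<And>G. G \<in> facet_graphs E \<Longrightarrow> is_basis G (b0, base_edge G)"
begin

definition jaeger_pairs :: "(('v \<times> 'v) set \<times> 'v set set) set" where
  "jaeger_pairs = {(G, T). G \<in> facet_graphs E \<and> jaeger_tree G (rib G) (b0, base_edge G) T}"

lemma ribbon_digraph_facet:
  assumes "G \<in> facet_graphs E"
  shows "ribbon_digraph G (rib G) b0 (base_edge G)"
proof
  show "(h, t) \<notin> G" if "(t, h) \<in> G" for t h
    using assms that by (auto simp: facet_graphs_def facet_graph_iff)
qed (use assms rib basis in auto)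

lemma jaeger_pairs_tree:
  assumes "(G, T) \<in> jaeger_pairs"
  shows "T \<subseteq> underlying G" "tree T" "otree (arcs G T)"
proof -
  have G: "G \<in> facet_graphs E" and "jaeger_tree G (rib G) (b0, base_edge G) T"
    using assms by (simp_all add: jaeger_pairs_def)
  then have sp: "spanning_tree (underlying G) T" by (simp add: jaeger_tree_def)
  interpret ribbon_digraph G "rib G" b0 "base_edge G" by (rule ribbon_digraph_facet[OF G])
  show T: "T \<subseteq> underlying G" "tree T" using sp by (simp_all add: spanning_tree_iff_tree)
  show "otree (arcs G T)" by (rule otree_arcs[OF T])
qed

text \<open>Natural coefficients meet the weak inequality of the head-edges automatically, so only
  the tail-edges impose a condition.\<close>

lemma positive_perturb_iff:
  assumes J: "(G, T) \<in> jaeger_pairs" and fl: "flow (arcs G T) (\<lambda>g. int (c g)) x"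
  shows "positive (arcs G T) (perturb b0 x) \<longleftrightarrow> (\<forall>g\<in>tail_edges G b0 T. 0 < c g)"
proof -
  note T = jaeger_pairs_tree[OF J]
  have "cut (arcs G T) x g = int (c g)" if "g \<in> arcs G T" for g
    using flow_unique[OF T(3) fl that] by simp
  then show ?thesis
    unfolding positive_def tail_edges_eq[OF T(1,2)] by (auto simp: cut_perturb[OF T(3)])
qed

lemma cell_exists:
  assumes "generic y"
  obtains G T where "(G, T) \<in> jaeger_pairs" "positive (arcs G T) y"
proof -
  obtain A l where A: "otree A" "positive A y" "layering E l" "A \<subseteq> facet_graph E l"
    using exists_facet[OF E assms] .
  let ?G = "facet_graph E l"
  have G: "?G \<in> facet_graphs E" using A(3) by (auto simp: facet_graphs_def)
  interpret ribbon_digraph ?G "rib ?G" b0 "base_edge ?G" by (rule ribbon_digraph_facet[OF G])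
  have l: "l h - l t = 1" if "(t, h) \<in> ?G" for t h using that by (simp add: facet_graph_iff)
  obtain T where "jaeger_tree ?G (rib ?G) (b0, base_edge ?G) T" "positive (arcs ?G T) y"
    using jaeger_exists[OF assms l A(1,2,4)] .
  then show ?thesis using that[of ?G T] G by (simp add: jaeger_pairs_def)
qed

text \<open>The facet graph is determined before any ribbon structure enters, so the choices made on
  different facet graphs never meet.\<close>

lemma cell_unique:
  assumes y: "generic y" and 1: "(G, T) \<in> jaeger_pairs" "positive (arcs G T) y"
    and 2: "(G', T') \<in> jaeger_pairs" "positive (arcs G' T') y"
  shows "G = G' \<and> T = T'"
proof -
  have G: "G \<in> facet_graphs E" "G' \<in> facet_graphs E" using 1 2 by (simp_all add: jaeger_pairs_def)
  obtain l where l: "G = facet_graph E l" "layering E l" using G(1) by (auto simp: facet_graphs_def)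
  obtain l' where l': "G' = facet_graph E l'" "layering E l'" using G(2) by (auto simp: facet_graphs_def)
  have "arcs G T \<subseteq> G" "arcs G' T' \<subseteq> G'" by (auto simp: arcs_def)
  then have eq: "G = G'"
    using facet_unique[OF y jaeger_pairs_tree(3)[OF 1(1)] 1(2) _ l(2)
        jaeger_pairs_tree(3)[OF 2(1)] 2(2) _ l'(2)] l(1) l'(1) by simp
  interpret ribbon_digraph G "rib G" b0 "base_edge G" by (rule ribbon_digraph_facet[OF G(1)])
  show ?thesis
    using jaeger_unique[OF y, of T T'] 1 2 eq by (simp add: jaeger_pairs_def)
qed

text \<open>Both coefficient vectors are flows for the same demand; its perturbation selects the
  cell, and within the cell the flow is unique. This covers the disjointness of the cells and the
  injectivity of \<open>emb\<close> on each.\<close>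

lemma emb_unique:
  assumes 1: "(G, T) \<in> jaeger_pairs" "c \<in> comps (arcs G T) (tail_edges G b0 T) k"
    and 2: "(G', T') \<in> jaeger_pairs" "c' \<in> comps (arcs G' T') (tail_edges G' b0 T') k"
    and eq: "emb (arcs G T) c = emb (arcs G' T') c'"
  shows "(G, T) = (G', T') \<and> c = c'"
proof -
  define x where "x v = (\<Sum>g\<in>arcs G T. int (c g) * (of_bool (snd g \<in> {v}) - of_bool (fst g \<in> {v})))" for v
  have "emb (arcs G T) c = (\<chi> v. real_of_int (x v))"
    by (simp add: vec_eq_iff emb_nth x_def)
  then have fl: "flow (arcs G T) (\<lambda>g. int (c g)) x" "flow (arcs G' T') (\<lambda>g. int (c' g)) x"
    using eq by (simp_all add: flow_iff_emb)
  have gen: "generic (perturb b0 x)"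
    using flow_sum_zero[OF fl(1)] by (rule generic_perturb)
  have "positive (arcs G T) (perturb b0 x)" "positive (arcs G' T') (perturb b0 x)"
    using positive_perturb_iff[OF 1(1) fl(1)] positive_perturb_iff[OF 2(1) fl(2)] 1(2) 2(2)
    by (simp_all add: comps_def)
  then have GT: "G = G'" "T = T'" using cell_unique[OF gen 1(1) _ 2(1)] by auto
  have "c g = c' g" for g
  proof (cases "g \<in> arcs G T")
    case True
    then have "int (c g) = int (c' g)"
      using flow_unique[OF jaeger_pairs_tree(3)[OF 1(1)]] fl GT by metis
    then show ?thesis by simp
  next
    case False
    then have "c g = 0" "c' g = 0"
      using 1(2) 2(2) GT unfolding comps_def by blast+
    then show ?thesis by simp
  qed
  then show ?thesis using GT by auto
qed

text \<open>Some facet graph always exists, and its base edge lies in \<open>E\<close>. So the basis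
  hypothesis excludes the one-vertex graph, whose polytope would be empty.\<close>

lemma E_nonempty: "E \<noteq> {}"
proof -
  have "generic (perturb b0 (\<lambda>_. 0))" by (rule generic_perturb) simp
  then obtain G T where "(G, T) \<in> jaeger_pairs" using cell_exists by blast
  then have G: "G \<in> facet_graphs E" by (simp add: jaeger_pairs_def)
  then have "base_edge G \<in> underlying G"
    using basis by (simp add: is_basis_def incident_edges_def)
  moreover have "underlying G \<subseteq> E"
    using G by (auto simp: facet_graphs_def underlying_facet_graph layer_edges_def)
  ultimately show ?thesis by blast
qed

lemma emb_in_dilate:
  assumes G: "G \<in> facet_graphs E" and c: "(\<Sum>g\<in>arcs G T. c g) \<le> k"
  shows "emb (arcs G T) c \<in> (\<lambda>x. real k *\<^sub>R x) ` symmetric_edge_polytope E"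
proof -
  let ?P = "symmetric_edge_polytope E"
  have conv: "convex ?P" by (simp add: symmetric_edge_polytope_def)
  have 0: "0 \<in> ?P" using zero_in_symmetric_edge_polytope E(1) E_nonempty .
  have arc: "arc_vec g \<in> ?P" if "g \<in> arcs G T" for g
  proof -
    have "(fst g, snd g) \<in> G" using that by (simp add: arcs_def)
    moreover obtain l where "G = facet_graph E l" using G by (auto simp: facet_graphs_def)
    ultimately have "{fst g, snd g} \<in> E" by (metis facet_graph_iff)
    then have "{snd g, fst g} \<in> E" by (simp only: insert_commute)
    then show ?thesis
      unfolding symmetric_edge_polytope_def arc_vec_def by (blast intro: hull_inc)
  qed
  define s where "s = (\<Sum>g\<in>arcs G T. c g)"
  show ?thesis
  proof (cases "s = 0")
    case True
    then have "c g = 0" if "g \<in> arcs G T" for g using that by (simp add: s_def)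
    then have "emb (arcs G T) c = real k *\<^sub>R 0" by (simp add: emb_def)
    then show ?thesis using 0 by (rule image_eqI)
  next
    case False
    then have s: "0 < s" "s \<le> k" using c[folded s_def] by simp_all
    \<comment> \<open>The coefficients are normalised to a convex combination of vertices; the
      missing weight \<open>k - s\<close> goes to the origin.\<close>
    define q where "q = (\<Sum>g\<in>arcs G T. (real (c g) / real s) *\<^sub>R (arc_vec g :: real ^ 'v))"
    have "q \<in> ?P"
      unfolding q_def
    proof (rule convex_sum)
      show "(\<Sum>g\<in>arcs G T. real (c g) / real s) = 1"
        unfolding sum_divide_distrib[symmetric] of_nat_sum[symmetric] s_def[symmetric]
        using s(1) by simp
    qed (use conv arc in auto)
    then have "(real s / real k) *\<^sub>R q + (1 - real s / real k) *\<^sub>R 0 \<in> ?P"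
      using s 0 by (intro convexD[OF conv]) auto
    moreover have "emb (arcs G T) c = real k *\<^sub>R ((real s / real k) *\<^sub>R q + (1 - real s / real k) *\<^sub>R 0)"
      using s by (simp add: emb_def q_def scaleR_sum_right)
    ultimately show ?thesis by (simp only: image_eqI)
  qed
qed

lemma sum_zero_on_polytope:
  assumes "p \<in> symmetric_edge_polytope E"
  shows "1 \<bullet> p = 0"
proof -
  have "symmetric_edge_polytope E \<subseteq> {x. 1 \<bullet> x = 0}"
    unfolding symmetric_edge_polytope_def
    by (rule hull_minimal) (auto simp: inner_diff_right inner_axis convex_hyperplane)
  then show ?thesis using assms by blast
qed

text \<open>The supporting inequality of the facet of \<open>l\<close>; it bounds the coefficient
  sum in \<open>lattice_point_in_cell\<close>.\<close>

lemma layering_on_polytope: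
  assumes "layering E l" "p \<in> symmetric_edge_polytope E"
  shows "(\<chi> v. real_of_int (l v)) \<bullet> p \<le> 1"
proof -
  have "symmetric_edge_polytope E \<subseteq> {x. (\<chi> v. real_of_int (l v)) \<bullet> x \<le> 1}"
    unfolding symmetric_edge_polytope_def
  proof (rule hull_minimal)
    show "{axis u 1 - axis v 1 | u v. {u, v} \<in> E} \<subseteq> {x. (\<chi> v. real_of_int (l v)) \<bullet> x \<le> 1}"
    proof
      fix w :: "real ^ 'v" assume "w \<in> {axis u 1 - axis v 1 | u v. {u, v} \<in> E}"
      then obtain u v where w: "w = axis u 1 - axis v 1" "{u, v} \<in> E" by blast
      then have "\<bar>l u - l v\<bar> \<le> 1" using assms(1) by (simp add: layering_def)
      then have "real_of_int (l u - l v) \<le> 1" by linarith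
      then show "w \<in> {x. (\<chi> v. real_of_int (l v)) \<bullet> x \<le> 1}"
        by (simp add: w(1) inner_diff_right inner_axis)
    qed
  qed (rule convex_halfspace_le)
  then show ?thesis using assms(2) by blast
qed

lemma lattice_point_in_cell:
  assumes p: "p \<in> symmetric_edge_polytope E" and int: "\<And>i. (real k *\<^sub>R p) $ i \<in> \<int>"
  obtains G T c where "(G, T) \<in> jaeger_pairs" "c \<in> comps (arcs G T) (tail_edges G b0 T) k"
    "emb (arcs G T) c = real k *\<^sub>R p"
proof -
  have "\<forall>i. \<exists>z. (real k *\<^sub>R p) $ i = real_of_int z" using int by (auto elim: Ints_cases)
  then obtain x where x: "(real k *\<^sub>R p) $ i = real_of_int (x i)" for i by metis
  have kp: "real k *\<^sub>R p = (\<chi> i. real_of_int (x i))" by (simp add: vec_eq_iff x del: vector_scaleR_component)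
  have "real_of_int (\<Sum>v\<in>UNIV. x v) = 1 \<bullet> (real k *\<^sub>R p)"
    unfolding kp by (simp add: inner_vec_def)
  also have "\<dots> = 0" using sum_zero_on_polytope[OF p] by simp
  finally have x0: "(\<Sum>v\<in>UNIV. x v) = 0" by (simp only: of_int_eq_0_iff)
  obtain G T where J: "(G, T) \<in> jaeger_pairs" and pos: "positive (arcs G T) (perturb b0 x)"
    using cell_exists[OF generic_perturb[OF x0]] by blast
  let ?A = "arcs G T"
  note T = jaeger_pairs_tree[OF J]
  define c where "c g = (if g \<in> ?A then nat (cut ?A x g) else 0)" for g
  have "0 \<le> cut ?A x g" if "g \<in> ?A" for g
  proof -
    have "0 < cut ?A (perturb b0 x) g" using pos that by (simp add: positive_def)
    then show ?thesis using cut_perturb[OF T(3) that] by (simp split: if_splits)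
  qed
  then have c: "int (c g) = cut ?A x g" if "g \<in> ?A" for g using that by (simp add: c_def)
  have fl: "flow ?A (\<lambda>g. int (c g)) x"
    using flow_cut[OF T(3) x0] c by (simp add: flow_def cong: sum.cong)
  then have emb: "emb ?A c = real k *\<^sub>R p" using flow_iff_emb kp by metis
  obtain l where l: "G = facet_graph E l" "layering E l"
    using J by (auto simp: jaeger_pairs_def facet_graphs_def)
  \<comment> \<open>On the facet graph \<open>l\<close> pairs to 1 with every arc, so the
    coefficient sum is the pairing of \<open>l\<close> with the point, which is at most
    \<open>k\<close>.\<close>
  have "real (\<Sum>g\<in>?A. c g) = (\<Sum>g\<in>?A. real (c g) * (real_of_int (l (snd g)) - real_of_int (l (fst g))))"
    unfolding of_nat_sum
  proof (intro sum.cong refl)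
    fix g assume "g \<in> ?A"
    then have "(fst g, snd g) \<in> facet_graph E l" using l(1) by (simp add: arcs_def)
    then have "l (snd g) - l (fst g) = 1" unfolding facet_graph_iff by (rule conjunct2)
    then have "real_of_int (l (snd g)) - real_of_int (l (fst g)) = 1"
      by (metis of_int_1 of_int_diff)
    then show "real (c g) = real (c g) * (real_of_int (l (snd g)) - real_of_int (l (fst g)))" by simp
  qed
  also have "\<dots> = (\<chi> v. real_of_int (l v)) \<bullet> emb ?A c" by (simp add: inner_emb)
  also have "\<dots> = real k * ((\<chi> v. real_of_int (l v)) \<bullet> p)" by (simp add: emb)
  also have "\<dots> \<le> real k * 1"
    using layering_on_polytope[OF l(2) p] by (intro mult_left_mono) auto
  finally have "(\<Sum>g\<in>?A. c g) \<le> k" by (simp only: mult_1_right of_nat_le_iff)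
  moreover have "\<forall>g\<in>tail_edges G b0 T. 0 < c g" using positive_perturb_iff[OF J fl] pos by blast
  ultimately have "c \<in> comps ?A (tail_edges G b0 T) k" by (simp add: comps_def c_def)
  then show ?thesis using that J emb by blast
qed

lemma lattice_points_eq:
  "(\<lambda>x. real k *\<^sub>R x) ` symmetric_edge_polytope E \<inter> {x. \<forall>i. x $ i \<in> \<int>} =
    (\<Union>(G, T)\<in>jaeger_pairs. emb (arcs G T) ` comps (arcs G T) (tail_edges G b0 T) k)" (is "?L = ?R")
proof
  show "?L \<subseteq> ?R"
  proof
    fix x assume "x \<in> ?L"
    then obtain p where x: "x = real k *\<^sub>R p" and p: "p \<in> symmetric_edge_polytope E"
      and int: "\<And>i. (real k *\<^sub>R p) $ i \<in> \<int>"
      by blast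
    obtain G T c where "(G, T) \<in> jaeger_pairs" "c \<in> comps (arcs G T) (tail_edges G b0 T) k"
      "emb (arcs G T) c = real k *\<^sub>R p"
      using lattice_point_in_cell[OF p int] .
    then show "x \<in> ?R" using x by (intro UN_I[of "(G, T)"]) (auto intro: image_eqI[of _ _ c])
  qed
  have "emb A c $ i \<in> \<int>" for A c and i :: 'v by (simp only: emb_nth Ints_of_int)
  then show "?R \<subseteq> ?L"
    using emb_in_dilate by (auto simp: jaeger_pairs_def comps_def)
qed

lemma card_lattice_points:
  "card ((\<lambda>x. real k *\<^sub>R x) ` symmetric_edge_polytope E \<inter> {x. \<forall>i. x $ i \<in> \<int>}) =
    (\<Sum>(G, T)\<in>jaeger_pairs. card (comps (arcs G T) (tail_edges G b0 T) k))"
proof -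
  let ?C = "\<lambda>(G, T). comps (arcs G T) (tail_edges G b0 T) k"
  let ?I = "\<lambda>(G, T). emb (arcs G T) ` comps (arcs G T) (tail_edges G b0 T) k"
  have "card (\<Union>j\<in>jaeger_pairs. ?I j) = (\<Sum>j\<in>jaeger_pairs. card (?I j))"
  proof (rule card_UN_disjoint)
    show "\<forall>j\<in>jaeger_pairs. finite (?I j)" by (auto simp: finite_comps)
    show "\<forall>i\<in>jaeger_pairs. \<forall>j\<in>jaeger_pairs. i \<noteq> j \<longrightarrow> ?I i \<inter> ?I j = {}"
    proof (intro ballI impI)
      fix i j assume ij: "i \<in> jaeger_pairs" "j \<in> jaeger_pairs" "i \<noteq> j"
      obtain G T G' T' where "i = (G, T)" "j = (G', T')" by (cases i, cases j)
      then show "?I i \<inter> ?I j = {}"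
        using ij emb_unique[of G T _ k G' T'] by auto
    qed
  qed simp
  also have "\<dots> = (\<Sum>j\<in>jaeger_pairs. card (?C j))"
  proof (intro sum.cong refl)
    fix j assume j: "j \<in> jaeger_pairs"
    obtain G T where GT: "j = (G, T)" by (cases j)
    have "inj_on (emb (arcs G T)) (comps (arcs G T) (tail_edges G b0 T) k)"
      using emb_unique[of G T _ k G T] j GT by (intro inj_onI) blast
    then show "card (?I j) = card (?C j)" by (simp add: GT card_image)
  qed
  finally show ?thesis unfolding lattice_points_eq by (simp add: case_prod_unfold)
qed

section \<open>The Ehrhart series and the h-star polynomial\<close>

lemma ehrhart_series_times:
  "ehrhart_series (symmetric_edge_polytope E) * (1 - fps_X) ^ CARD('v) =
    fps_of_poly (\<Sum>(G, T)\<in>jaeger_pairs. monom 1 (card (tail_edges G b0 T)))"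
proof -
  let ?F = "\<lambda>(G, T). Abs_fps (\<lambda>k. real (card (comps (arcs G T) (tail_edges G b0 T) k)))"
  have "ehrhart_series (symmetric_edge_polytope E) = (\<Sum>j\<in>jaeger_pairs. ?F j)"
    by (intro fps_ext)
      (simp add: ehrhart_series_def card_lattice_points fps_sum_nth case_prod_unfold)
  then have "ehrhart_series (symmetric_edge_polytope E) * (1 - fps_X) ^ CARD('v) =
    (\<Sum>j\<in>jaeger_pairs. ?F j * (1 - fps_X) ^ CARD('v))"
    by (simp add: sum_distrib_right)
  also have "\<dots> = (\<Sum>(G, T)\<in>jaeger_pairs. fps_X ^ card (tail_edges G b0 T))"
  proof (intro sum.cong refl)
    fix j assume j: "j \<in> jaeger_pairs"
    obtain G T where GT: "j = (G, T)" by (cases j)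
    note T = jaeger_pairs_tree[OF j[unfolded GT]]
    have "Suc (card (arcs G T)) = CARD('v)"
      using card_otree[OF T(3)] by simp
    moreover have "tail_edges G b0 T \<subseteq> arcs G T" unfolding tail_edges_eq[OF T(1,2)] by blast
    ultimately have "Abs_fps (\<lambda>k. real (card (comps (arcs G T) (tail_edges G b0 T) k))) *
      (1 - fps_X) ^ CARD('v) = fps_X ^ card (tail_edges G b0 T)"
      using fps_comps[of "arcs G T" "tail_edges G b0 T"] by simp
    then show "?F j * (1 - fps_X) ^ CARD('v) = (case j of (G, T) \<Rightarrow> fps_X ^ card (tail_edges G b0 T))"
      by (simp add: GT)
  qed
  also have "\<dots> = fps_of_poly (\<Sum>(G, T)\<in>jaeger_pairs. monom 1 (card (tail_edges G b0 T)))"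
    by (simp add: fps_of_poly_sum fps_of_poly_monom' case_prod_unfold)
  finally show ?thesis .
qed

lemma h_star_eq:
  "h_star (symmetric_edge_polytope E) = (\<Sum>(G, T)\<in>jaeger_pairs. monom 1 (card (tail_edges G b0 T)))"
proof (rule h_star_eqI)
  have "(1 - fps_X :: real fps) ^ CARD('v) \<noteq> 0"
  proof
    assume "(1 - fps_X :: real fps) ^ CARD('v) = 0"
    then have "fps_nth ((1 - fps_X :: real fps) ^ CARD('v)) 0 = 0" by simp
    then show False by (simp add: fps_power_zeroth)
  qed
  moreover have "nat (aff_dim (symmetric_edge_polytope E)) + 1 = CARD('v)"
    unfolding aff_dim_symmetric_edge_polytope[OF E E_nonempty] by (simp only: nat_int) simp
  ultimately show "ehrhart_series (symmetric_edge_polytope E) =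
    fps_of_poly (\<Sum>(G, T)\<in>jaeger_pairs. monom 1 (card (tail_edges G b0 T))) /
      (1 - fps_X) ^ (nat (aff_dim (symmetric_edge_polytope E)) + 1)"
    by (simp add: nonzero_mult_div_cancel_right flip: ehrhart_series_times)
qed

end

theorem theorem3p4:
  fixes E :: "'v::finite set set"
    and b0 :: 'v
    and rib :: "('v \<times> 'v) set \<Rightarrow> 'v \<Rightarrow> 'v set \<Rightarrow> 'v set"
    and base_edge :: "('v \<times> 'v) set \<Rightarrow> 'v set"
    and i :: nat
  assumes "simple_graph E"
    and "connected_graph E"
    and "\<And>G. G \<in> facet_graphs E \<Longrightarrow> ribbon_structure G (rib G)"
    and "\<And>G. G \<in> facet_graphs E \<Longrightarrow> is_basis G (b0, base_edge G)"
  shows "poly.coeff (h_star (symmetric_edge_polytope E)) i =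
    real (card {(G, T). G \<in> facet_graphs E \<and> jaeger_tree G (rib G) (b0, base_edge G) T \<and>
                        card (tail_edges G b0 T) = i})"
proof -
  interpret ribbon_family E b0 rib base_edge by unfold_locales (use assms in auto)
  have "poly.coeff (h_star (symmetric_edge_polytope E)) i =
    (\<Sum>j\<in>jaeger_pairs. of_bool (card (tail_edges (fst j) b0 (snd j)) = i))"
    by (simp add: h_star_eq coeff_sum case_prod_unfold of_bool_def)
  also have "\<dots> = real (card (jaeger_pairs \<inter> {j. card (tail_edges (fst j) b0 (snd j)) = i}))"
    by (simp add: of_bool_def sum.If_cases)
  also have "jaeger_pairs \<inter> {j. card (tail_edges (fst j) b0 (snd j)) = i} =
    {(G, T). G \<in> facet_graphs E \<and> jaeger_tree G (rib G) (b0, base_edge G) T \<and>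
      card (tail_edges G b0 T) = i}"
    by (auto simp: jaeger_pairs_def)
  finally show ?thesis .
qed

end
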